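(* Let $P(z)=\sum_{n\ge0}P_nz^n$ be the unique formal power series satisfying $P=1+\frac{zP^2}{1-z^3P^2}$, and let $Q_n$ be as in the context. For every $n>0$, $$P_n=\sum_{0\le k<n/3}\frac{1}{n-k+1}\binom{n-2k-1}{k}\binom{2n-4k}{n-3k},$$ $$Q_n=\sum_{\substack{0\le s\le k,\\ 0\le k<n/3}}\frac{3(k-s)+2}{n-s+1}\binom{n-3k+s-2}{s}\binom{2n-3k-s-1}{n-3k-1},$$ where $k$ and $s$ range over integers.
   Context: For $n\ge1$, fix a convex $(n+2)$-gon with vertices labelled $0,1,\dots,n+1$ in cyclic order. A dissection is a set of pairwise non-crossing diagonals (chords); these partition the polygon into sub-polygons (cells). The quiddity of a dissection is the tuple $(a_0,\dots,a_{n+1})$ with $a_i$ the number of cells having vertex $i$. A dissection is 3-periodic if every cell has a number of vertices divisible by $3$. $Q_n$ is the number of distinct tuples occurring as quiddities of 3-periodic dissections of the $(n+2)$-gon. *)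

theory Defs
  imports Complex_Main "HOL-Computational_Algebra.Formal_Power_Series"
begin

text \<open>
  A polygon is represented by its set of vertices \<open>V\<close>, a finite set of natural numbers with
  at least three elements, whose cyclic order is induced by \<open><\<close>.  A chord is a pair
  \<open>(u, v)\<close> with \<open>u < v\<close>.  It is a side when \<open>u\<close> and \<open>v\<close> are cyclically
  consecutive in \<open>V\<close>: no vertex lies strictly between them, or \<open>u\<close> is the least and
  \<open>v\<close> the greatest vertex.
\<close>

definition polygon_sides :: "nat set \<Rightarrow> (nat \<times> nat) set" where
  "polygon_sides V =
     {(u, v). u \<in> V \<and> v \<in> V \<and> u < v \<and> (V \<inter> {u<..<v} = {} \<or> V \<subseteq> {u..v})}"

definition polygon_diagonals :: "nat set \<Rightarrow> (nat \<times> nat) set" where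
  "polygon_diagonals V = {(u, v). u \<in> V \<and> v \<in> V \<and> u < v} - polygon_sides V"

text \<open>Chords sharing an endpoint do not cross.\<close>

definition crossing :: "nat \<times> nat \<Rightarrow> nat \<times> nat \<Rightarrow> bool" where
  "crossing d e \<longleftrightarrow>
     (fst d < fst e \<and> fst e < snd d \<and> snd d < snd e) \<or>
     (fst e < fst d \<and> fst d < snd e \<and> snd e < snd d)"

definition dissection :: "nat set \<Rightarrow> (nat \<times> nat) set \<Rightarrow> bool" where
  "dissection V D \<longleftrightarrow> D \<subseteq> polygon_diagonals V \<and> (\<forall>d\<in>D. \<forall>e\<in>D. \<not> crossing d e)"

text \<open>
  A cell, given by its vertex set, is a sub-polygon bounded by sides of the polygon and diagonals
  of the dissection, and not cut further by any diagonal of the dissection.  A diagonal running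
  through the interior of a sub-polygon bounded in this way must join two of its vertices, since
  otherwise it would cross one of its sides.
\<close>

definition cells :: "nat set \<Rightarrow> (nat \<times> nat) set \<Rightarrow> nat set set" where
  "cells V D =
     {C. C \<subseteq> V \<and> 3 \<le> card C \<and> polygon_sides C \<subseteq> polygon_sides V \<union> D \<and>
         polygon_diagonals C \<inter> D = {}}"

definition three_periodic :: "nat set \<Rightarrow> (nat \<times> nat) set \<Rightarrow> bool" where
  "three_periodic V D \<longleftrightarrow> dissection V D \<and> (\<forall>C\<in>cells V D. 3 dvd card C)"

definition quiddity :: "nat \<Rightarrow> (nat \<times> nat) set \<Rightarrow> nat list" where
  "quiddity n D = map (\<lambda>i. card {C \<in> cells {0..n+1} D. i \<in> C}) [0..<n+2]"

definition Q :: "nat \<Rightarrow> nat" where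
  "Q n = card {quiddity n D | D. three_periodic {0..n+1} D}"

text \<open>The denominator has constant coefficient 1, so the division is by a unit.\<close>

definition P_equation :: "real fps \<Rightarrow> bool" where
  "P_equation P \<longleftrightarrow> P = 1 + fps_X * P ^ 2 / (1 - fps_X ^ 3 * P ^ 2)"

definition P_series :: "real fps" where
  "P_series = (THE P. P_equation P)"

end

theory Submission
  imports Defs
begin

text \<open>
  Cutting along a diagonal shows that the quiddities of 3-periodic dissections are the tuples
  obtained from constant tuples \<open>(1, \<dots>, 1)\<close> of length divisible by 3 by gluing polygons along a side.
  Read as a word in the generators of \<open>PSL(2, Z) = Z\<^sub>2 * Z\<^sub>3\<close>, such a tuple is a relation: this holds for
  \<open>(1, \<dots>, 1)\<close> because one generator has order 3, and is preserved by gluing. Conversely a trivial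
  word is a closed walk on a tree of triangles; decomposing it into excursions exhibits it as an
  iterated gluing, and does so uniquely. The decomposition gives
  \<open>G = z + E\<close>, \<open>E = G\<^sup>2 + z G\<^sup>2 E\<close> and \<open>R = G\<^sup>2 + G\<^sup>3 R\<close> for the generating functions of gaps, excursions and
  closed walks. Hence \<open>G = z P\<close>, and \<open>Q\<^sub>n\<close> is the coefficient of \<open>z\<^sup>n\<close> in \<open>z P\<^sup>2 / (1 - z\<^sup>3 P\<^sup>3)\<close>. The
  coefficients of the powers of \<open>P\<close> follow by checking the recurrence that the equation for \<open>P\<close>
  imposes on them.
\<close>

section \<open>Dissections cut along a diagonal\<close>

lemma polygon_sides_iff:
  "(x, y) \<in> polygon_sides V \<longleftrightarrow>
     x \<in> V \<and> y \<in> V \<and> x < y \<and> ((\<forall>z\<in>V. \<not> (x < z \<and> z < y)) \<or> (\<forall>z\<in>V. x \<le> z \<and> z \<le> y))"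
  unfolding polygon_sides_def by auto

lemma polygon_diagonals_iff:
  "(x, y) \<in> polygon_diagonals V \<longleftrightarrow>
     x \<in> V \<and> y \<in> V \<and> x < y \<and> (\<exists>z\<in>V. x < z \<and> z < y) \<and> (\<exists>z\<in>V. z < x \<or> y < z)"
  unfolding polygon_diagonals_def by (auto simp: polygon_sides_iff not_le)

lemma crossing_iff:
  "crossing (u, v) (x, y) \<longleftrightarrow> (u < x \<and> x < v \<and> v < y) \<or> (x < u \<and> u < y \<and> y < v)"
  unfolding crossing_def by simp

text \<open>Supplies the side of a sub-polygon that passes over a given point; if that point is a
  polygon vertex missing from the sub-polygon, this side cuts it off.\<close>

lemma consecutive_below_above:
  fixes C :: "nat set"
  assumes "finite C" "\<exists>c\<in>C. c \<le> z" "\<exists>c\<in>C. z < c"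
  obtains x y where "(x, y) \<in> polygon_sides C" "x \<le> z" "z < y" "\<And>c. c \<in> C \<Longrightarrow> c \<le> x \<or> y \<le> c"
proof -
  let ?A = "{c\<in>C. c \<le> z}" and ?B = "{c\<in>C. z < c}"
  have fin: "finite ?A" "finite ?B" "?A \<noteq> {}" "?B \<noteq> {}"
    using assms by auto
  have A: "Max ?A \<in> C" "Max ?A \<le> z" using Max_in[OF fin(1,3)] by auto
  have B: "Min ?B \<in> C" "z < Min ?B" using Min_in[OF fin(2,4)] by auto
  have gap: "c \<le> Max ?A \<or> Min ?B \<le> c" if "c \<in> C" for c
    using fin that by (cases "c \<le> z") auto
  then have "(Max ?A, Min ?B) \<in> polygon_sides C"
    unfolding polygon_sides_iff using A B by fastforce
  then show thesis using that A B gap by blast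
qed

lemma subset_pair_card: "C \<subseteq> {x, y} \<Longrightarrow> \<not> 3 \<le> card C"
proof
  assume "C \<subseteq> {x, y}" "3 \<le> card C"
  then show False using card_mono[of "{x, y}" C] by (simp add: card_insert_if split: if_splits)
qed

text \<open>The side of \<open>C\<close> skipping a missing vertex \<open>z\<close> would be a side
  of \<open>V\<close>, so all of \<open>V\<close> lies on one side of it and \<open>C\<close>
  shrinks to its two endpoints.\<close>

lemma cells_empty:
  assumes "finite V" "3 \<le> card V"
  shows "cells V {} = {V}"
proof (intro equalityI subsetI)
  fix C assume "C \<in> cells V {}"
  then have C: "C \<subseteq> V" "3 \<le> card C" "polygon_sides C \<subseteq> polygon_sides V"
    unfolding cells_def by auto
  have fin: "finite C" using C(1) assms(1) finite_subset by blast
  have ne: "C \<noteq> {}" using C(2) by auto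
  have "z \<in> C" if z: "z \<in> V" for z
  proof (rule ccontr)
    assume zC: "z \<notin> C"
    show False
    proof (cases "(\<exists>c\<in>C. c \<le> z) \<and> (\<exists>c\<in>C. z < c)")
      case True
      then obtain x y where side: "(x, y) \<in> polygon_sides C" and xy: "x \<le> z" "z < y"
        and gap: "\<And>c. c \<in> C \<Longrightarrow> c \<le> x \<or> y \<le> c"
        using consecutive_below_above[OF fin] by blast
      have "x \<in> C" using side by (simp add: polygon_sides_iff)
      then have xz: "x < z" using xy zC by (cases "x = z") auto
      have "(x, y) \<in> polygon_sides V" using side C(3) by blast
      then have V: "\<forall>c\<in>V. x \<le> c \<and> c \<le> y"
        unfolding polygon_sides_iff using z xz xy by blast
      have "c \<in> {x, y}" if "c \<in> C" for c
      proof -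
        have "x \<le> c" "c \<le> y" using V C(1) that by blast+
        then show ?thesis using gap[OF that] by auto
      qed
      then have "C \<subseteq> {x, y}" by blast
      then show False using subset_pair_card C(2) by metis
    next
      \<comment> \<open>Here \<open>z\<close> is below or above all of \<open>C\<close>; the closing
        side from \<open>Min C\<close> to \<open>Max C\<close> cuts it off.\<close>
      case False
      have mm: "Min C \<in> C" "Max C \<in> C" "\<And>c. c \<in> C \<Longrightarrow> Min C \<le> c \<and> c \<le> Max C"
        using fin ne by auto
      have lt: "Min C < Max C"
      proof (rule ccontr)
        assume "\<not> Min C < Max C"
        then have "C \<subseteq> {Min C, Max C}" using mm(3) by force
        then show False using subset_pair_card C(2) by metis
      qed
      have "(Min C, Max C) \<in> polygon_sides C"
        unfolding polygon_sides_iff using mm lt by blast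
      then have "(Min C, Max C) \<in> polygon_sides V" using C(3) by blast
      moreover have "\<not> (Min C \<le> z \<and> z \<le> Max C)"
        using False mm zC by (metis le_neq_implies_less)
      ultimately have "\<forall>c\<in>V. \<not> (Min C < c \<and> c < Max C)"
        unfolding polygon_sides_iff using z by blast
      then have "C \<subseteq> {Min C, Max C}"
        using mm(3) C(1) by fastforce
      then show False using subset_pair_card C(2) by metis
    qed
  qed
  then show "C \<in> {V}" using C(1) by blast
next
  fix C assume "C \<in> {V}"
  then show "C \<in> cells V {}" using assms unfolding cells_def by auto
qed

text \<open>\<open>D1\<close> takes the diagonals inside the interval from \<open>u\<close> to
  \<open>v\<close>; not crossing \<open>(u, v)\<close> keeps the endpoints of all others out of the
  open interval.\<close>

lemma dissection_split:
  assumes D: "dissection V D" and d: "(u, v) \<in> D"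
  obtains D1 D2 where "dissection (V \<inter> {u..v}) D1" "dissection (V - {u<..<v}) D2"
    "D = insert (u, v) (D1 \<union> D2)"
proof -
  have diag: "\<And>x y. (x, y) \<in> D \<Longrightarrow> (x, y) \<in> polygon_diagonals V"
    and nc: "\<And>d e. d \<in> D \<Longrightarrow> e \<in> D \<Longrightarrow> \<not> crossing d e"
    using D unfolding dissection_def by blast+
  define D1 where "D1 = {(x, y) \<in> D. (x, y) \<noteq> (u, v) \<and> u \<le> x \<and> y \<le> v}"
  define D2 where "D2 = {(x, y) \<in> D. (x, y) \<noteq> (u, v) \<and> \<not> (u \<le> x \<and> y \<le> v)}"
  have uv: "u \<in> V" "v \<in> V" "u < v"
    using diag[OF d] by (auto simp: polygon_diagonals_iff)
  have "(x, y) \<in> polygon_diagonals (V \<inter> {u..v})" if "(x, y) \<in> D1" for x y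
  proof -
    have xy: "(x, y) \<in> D" "(x, y) \<noteq> (u, v)" "u \<le> x" "y \<le> v"
      using that unfolding D1_def by auto
    obtain z where z: "x \<in> V" "y \<in> V" "z \<in> V" "x < z" "z < y"
      using diag[OF xy(1)] unfolding polygon_diagonals_iff by blast
    have "z \<in> V \<inter> {u..v}" "x \<in> V \<inter> {u..v}" "y \<in> V \<inter> {u..v}" "u \<in> V \<inter> {u..v}" "v \<in> V \<inter> {u..v}"
      using xy uv z by auto
    moreover have "u < x \<or> y < v" using xy by auto
    ultimately show ?thesis
      unfolding polygon_diagonals_iff using z by (meson less_trans)
  qed
  then have "D1 \<subseteq> polygon_diagonals (V \<inter> {u..v})" by auto
  moreover have "(x, y) \<in> polygon_diagonals (V - {u<..<v})" if "(x, y) \<in> D2" for x y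
  proof -
    have xy: "(x, y) \<in> D" "(x, y) \<noteq> (u, v)" "\<not> (u \<le> x \<and> y \<le> v)"
      using that unfolding D2_def by auto
    obtain z z' where z: "x \<in> V" "y \<in> V" "x < y" "z \<in> V" "x < z" "z < y" "z' \<in> V" "z' < x \<or> y < z'"
      using diag[OF xy(1)] unfolding polygon_diagonals_iff by blast
    have out: "\<not> (u < x \<and> x < v)" "\<not> (u < y \<and> y < v)"
      using nc[OF d xy(1)] xy(3) z(3) by (auto simp: crossing_iff)
    \<comment> \<open>The vertex certifying a diagonal of \<open>V\<close> may have been cut off;
      then \<open>u\<close> or \<open>v\<close> replaces it.\<close>
    have 1: "\<exists>z\<in>V - {u<..<v}. x < z \<and> z < y"
    proof (cases "u < z \<and> z < v")
      case True
      then have "x \<le> u" "v \<le> y" using out z by auto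
      then have "x < u \<or> v < y" using xy(2) by auto
      then show ?thesis
        using \<open>x \<le> u\<close> \<open>v \<le> y\<close> uv by (auto intro: bexI[of _ u] bexI[of _ v])
    qed (use z in auto)
    have 2: "\<exists>z\<in>V - {u<..<v}. z < x \<or> y < z"
    proof (cases "u < z' \<and> z' < v")
      case True
      then have "u < x \<or> y < v" using z by auto
      then show ?thesis using uv by (auto intro: bexI[of _ u] bexI[of _ v])
    qed (use z in auto)
    show ?thesis using z out 1 2 by (auto simp: polygon_diagonals_iff)
  qed
  then have "D2 \<subseteq> polygon_diagonals (V - {u<..<v})" by auto
  moreover have "D = insert (u, v) (D1 \<union> D2)"
    unfolding D1_def D2_def using d by auto
  moreover have "D1 \<subseteq> D" "D2 \<subseteq> D" unfolding D1_def D2_def by auto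
  ultimately show thesis
    using nc that unfolding dissection_def by (metis subsetD)
qed

text \<open>Serves both directions: \<open>dissection_split\<close> cuts a dissection into such a
  pair, and \<open>gluing_word_realized\<close> assembles one from it.\<close>

locale glued_dissections =
  fixes V :: "nat set" and u v :: nat and D1 D2 :: "(nat \<times> nat) set"
  assumes diagonal: "(u, v) \<in> polygon_diagonals V"
    and diss1: "dissection (V \<inter> {u..v}) D1" and diss2: "dissection (V - {u<..<v}) D2"
    and fin: "finite V"
begin

abbreviation "V1 \<equiv> V \<inter> {u..v}"
abbreviation "V2 \<equiv> V - {u<..<v}"
abbreviation "D \<equiv> insert (u, v) (D1 \<union> D2)"

lemma uv: "u \<in> V" "v \<in> V" "u < v"
  using diagonal by (auto simp: polygon_diagonals_iff)

lemma diagonal_cases: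
  assumes "(x, y) \<in> D"
  obtains "x = u" "y = v" | "(x, y) \<in> D1" "(x, y) \<in> polygon_diagonals V1"
  | "(x, y) \<in> D2" "(x, y) \<in> polygon_diagonals V2"
  using assms diss1 diss2 unfolding dissection_def by blast

lemma inner_diagonal: "(x, y) \<in> polygon_diagonals V1 \<Longrightarrow> (x, y) \<in> polygon_diagonals V"
  unfolding polygon_diagonals_iff by blast

lemma outer_diagonal: "(x, y) \<in> polygon_diagonals V2 \<Longrightarrow> (x, y) \<in> polygon_diagonals V"
  unfolding polygon_diagonals_iff by blast

text \<open>The halves share only \<open>u\<close> and \<open>v\<close>, and \<open>(u, v)\<close>
  is a side of each, hence a diagonal of neither.\<close>

lemma not_both:
  "(x, y) \<in> polygon_diagonals V1 \<Longrightarrow> x \<in> V2 \<Longrightarrow> y \<in> V2 \<Longrightarrow> False"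
  "(x, y) \<in> polygon_diagonals V2 \<Longrightarrow> x \<in> V1 \<Longrightarrow> y \<in> V1 \<Longrightarrow> False"
  using uv unfolding polygon_diagonals_iff by fastforce+

lemma glued_dissection: "dissection V D"
  unfolding dissection_def
proof (intro conjI ballI)
  show "D \<subseteq> polygon_diagonals V"
    using diagonal inner_diagonal outer_diagonal diss1 diss2 unfolding dissection_def by auto
  have D: "D1 \<subseteq> polygon_diagonals V1" "D2 \<subseteq> polygon_diagonals V2"
    "\<forall>d\<in>D1. \<forall>e\<in>D1. \<not> crossing d e" "\<forall>d\<in>D2. \<forall>e\<in>D2. \<not> crossing d e"
    using diss1 diss2 unfolding dissection_def by auto
  have mixed: "\<not> crossing d e \<and> \<not> crossing e d" if "d \<in> insert (u,v) D1" "e \<in> insert (u,v) D2" for d e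
  proof -
    have "u \<le> fst d" "snd d \<le> v" "fst d < snd d"
      using that(1) D(1) uv by (cases d; auto simp: polygon_diagonals_iff dest!: subsetD)+
    moreover have "\<not> (u < fst e \<and> fst e < v)" "\<not> (u < snd e \<and> snd e < v)" "fst e < snd e"
      using that(2) D(2) uv by (cases e; auto simp: polygon_diagonals_iff dest!: subsetD)+
    ultimately show ?thesis unfolding crossing_def by linarith
  qed
  fix d e assume "d \<in> D" "e \<in> D"
  then show "\<not> crossing d e" using mixed D(3,4) by blast
qed

lemma inner_cell:
  assumes "C \<in> cells V1 D1"
  shows "C \<in> cells V D"
proof -
  have C: "C \<subseteq> V1" "3 \<le> card C" "polygon_sides C \<subseteq> polygon_sides V1 \<union> D1"
    "polygon_diagonals C \<inter> D1 = {}"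
    using assms unfolding cells_def by auto
  have "(x, y) \<in> polygon_sides V \<union> D" if side: "(x, y) \<in> polygon_sides V1" for x y
  proof -
    have xy: "x \<in> V" "y \<in> V" "x < y" "u \<le> x" "y \<le> v"
      using side by (auto simp: polygon_sides_iff)
    have "u \<in> V1" "v \<in> V1" using uv by auto
    then consider "\<forall>z\<in>V1. \<not> (x < z \<and> z < y)" | "x \<le> u" "v \<le> y"
      using side unfolding polygon_sides_iff by blast
    then show ?thesis
    proof cases
      case 1
      then have "\<forall>z\<in>V. \<not> (x < z \<and> z < y)" using xy by auto
      then show ?thesis using xy by (auto simp: polygon_sides_iff)
    qed (use xy in auto)
  qed
  then have "polygon_sides V1 \<subseteq> polygon_sides V \<union> D" by (rule subrelI)
  moreover have "(x, y) \<notin> D" if "(x, y) \<in> polygon_diagonals C" for x y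
  proof
    assume "(x, y) \<in> D"
    then show False
    proof (cases rule: diagonal_cases)
      case 1
      then show False using that C(1) by (auto simp: polygon_diagonals_iff)
    next
      case 2
      then show False using that C(4) by blast
    next
      case 3
      then show False using that C(1) not_both(2)[of x y] by (auto simp: polygon_diagonals_iff)
    qed
  qed
  ultimately have "polygon_sides C \<subseteq> polygon_sides V \<union> D" "polygon_diagonals C \<inter> D = {}"
    using C(3) by (blast, auto)
  then show ?thesis using C unfolding cells_def by auto
qed

lemma outer_cell:
  assumes "C \<in> cells V2 D2"
  shows "C \<in> cells V D"
proof -
  have C: "C \<subseteq> V2" "3 \<le> card C" "polygon_sides C \<subseteq> polygon_sides V2 \<union> D2"
    "polygon_diagonals C \<inter> D2 = {}"
    using assms unfolding cells_def by auto
  have "(x, y) \<in> polygon_sides V \<union> D" if xy: "(x, y) \<in> polygon_sides V2" for x y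
  proof (cases "\<forall>z\<in>V2. x \<le> z \<and> z \<le> y")
    case True
    then have "x \<le> u" "v \<le> y" using uv by auto
    then have "\<forall>z\<in>V. x \<le> z \<and> z \<le> y"
      using True by force
    then show ?thesis using xy by (auto simp: polygon_sides_iff)
  next
    case False
    then have *: "x \<in> V2" "y \<in> V2" "x < y" "\<forall>z\<in>V2. \<not> (x < z \<and> z < y)"
      using xy by (auto simp: polygon_sides_iff)
    show ?thesis
    proof (cases "\<forall>z\<in>V. \<not> (x < z \<and> z < y)")
      case True
      then show ?thesis using * by (auto simp: polygon_sides_iff)
    next
      case False
      \<comment> \<open>A side of \<open>V2\<close> that skips a vertex of \<open>V\<close> skips a
        removed one, so it spans \<open>u\<close> and \<open>v\<close>; being a side of
        \<open>V2\<close>, it is \<open>(u, v)\<close>.\<close>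
      then obtain z where z: "z \<in> V" "x < z" "z < y" by blast
      then have "u < z" "z < v" using * by auto
      then have le: "x \<le> u" "v \<le> y" using * z by auto
      moreover have "u \<in> V2" "v \<in> V2" using uv by auto
      then have "\<not> (x < u \<and> u < y)" "\<not> (x < v \<and> v < y)" using * by blast+
      ultimately have "x = u" "y = v" using uv by linarith+
      then show ?thesis by simp
    qed
  qed
  then have "polygon_sides V2 \<subseteq> polygon_sides V \<union> D" by (rule subrelI)
  moreover have "(x, y) \<notin> D" if "(x, y) \<in> polygon_diagonals C" for x y
  proof
    assume "(x, y) \<in> D"
    then show False
    proof (cases rule: diagonal_cases)
      case 1
      then show False using that C(1) by (auto simp: polygon_diagonals_iff)
    next
      case 2
      then show False using that C(1) not_both(1)[of x y] by (auto simp: polygon_diagonals_iff)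
    next
      case 3
      then show False using that C(4) by blast
    qed
  qed
  ultimately have "polygon_sides C \<subseteq> polygon_sides V \<union> D" "polygon_diagonals C \<inter> D = {}"
    using C(3) by (blast, auto)
  then show ?thesis using C unfolding cells_def by auto
qed

lemma glued_side_not_crossing:
  assumes "(x, y) \<in> polygon_sides V \<union> D"
  shows "\<not> crossing (u, v) (x, y)"
proof
  assume cr: "crossing (u, v) (x, y)"
  have "(x, y) \<notin> D" using cr glued_dissection unfolding dissection_def by blast
  then have "(x, y) \<in> polygon_sides V" using assms by blast
  then show False using cr uv unfolding crossing_iff polygon_sides_iff
    by (metis leD)
qed

text \<open>If a cell had vertices strictly on both sides of \<open>(u, v)\<close>, then, as none of
  its sides crosses \<open>(u, v)\<close>, both \<open>u\<close> and \<open>v\<close> would be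
  vertices of it. So \<open>(u, v)\<close> would be a diagonal of the cell, but it lies in
  \<open>D\<close>.\<close>

lemma cell_one_sided:
  assumes "C \<in> cells V D"
  shows "C \<subseteq> V1 \<or> C \<subseteq> V2"
proof (rule ccontr)
  assume "\<not> (C \<subseteq> V1 \<or> C \<subseteq> V2)"
  moreover have C: "C \<subseteq> V" "polygon_sides C \<subseteq> polygon_sides V \<union> D" "polygon_diagonals C \<inter> D = {}"
    using assms unfolding cells_def by auto
  ultimately obtain a b where a: "a \<in> C" "u < a" "a < v" and b: "b \<in> C" "b < u \<or> v < b"
    by (auto simp: subset_iff not_le)
  have fC: "finite C" using C(1) fin finite_subset by blast
  have side: "\<not> crossing (u, v) (x, y)" if "(x, y) \<in> polygon_sides C" for x y
    using that C(2) glued_side_not_crossing by blast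
  have minmax: "Min C \<in> C" "Max C \<in> C" "\<And>c. c \<in> C \<Longrightarrow> Min C \<le> c \<and> c \<le> Max C"
    using fC a(1) Min_in Max_in by auto
  \<comment> \<open>The closing side of \<open>C\<close> is used when \<open>C\<close> has no vertex
    up to \<open>u\<close>, or none above \<open>v\<close>.\<close>
  have base: "\<not> crossing (u, v) (Min C, Max C)"
  proof -
    have "(Min C, Max C) \<in> polygon_sides C" if "Min C < Max C"
      unfolding polygon_sides_iff using minmax that by blast
    then show ?thesis using side unfolding crossing_iff by fastforce
  qed
  have "u \<in> C"
  proof (rule ccontr)
    assume nu: "u \<notin> C"
    show False
    proof (cases "\<exists>c\<in>C. c \<le> u")
      case True
      then obtain x y where xy: "(x, y) \<in> polygon_sides C" "x \<le> u" "u < y"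
        and gap: "\<And>c. c \<in> C \<Longrightarrow> c \<le> x \<or> y \<le> c"
        using consecutive_below_above[OF fC, of u] a by blast
      have "y \<le> a" using gap[OF a(1)] a xy by linarith
      moreover have "x \<in> C" using xy by (simp add: polygon_sides_iff)
      then have "x < u" using xy nu by (cases "x = u") auto
      ultimately show False using side[OF xy(1)] a xy unfolding crossing_iff by linarith
    next
      case False
      then have "v < b" "u < Min C" using b minmax by auto
      then show False
        using base minmax(3)[OF a(1)] minmax(3)[OF b(1)] a unfolding crossing_iff by linarith
    qed
  qed
  moreover have "v \<in> C"
  proof (rule ccontr)
    assume nv: "v \<notin> C"
    show False
    proof (cases "\<exists>c\<in>C. v < c")
      case True
      moreover have "\<exists>c\<in>C. c \<le> v" using a by (auto intro: less_imp_le)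
      ultimately obtain x y where xy: "(x, y) \<in> polygon_sides C" "x \<le> v" "v < y"
        and gap: "\<And>c. c \<in> C \<Longrightarrow> c \<le> x \<or> y \<le> c"
        using consecutive_below_above[OF fC, of v] by blast
      have "a \<le> x" using gap[OF a(1)] a xy by linarith
      moreover have "x \<in> C" using xy by (simp add: polygon_sides_iff)
      then have "x < v" using xy nv by (cases "x = v") auto
      ultimately show False using side[OF xy(1)] a xy unfolding crossing_iff by linarith
    next
      case False
      then have "b < u" using b by blast
      moreover have "Max C < v" using False minmax(2) nv by (cases "Max C = v") auto
      ultimately show False
        using base minmax(3)[OF a(1)] minmax(3)[OF b(1)] a unfolding crossing_iff by linarith
    qed
  qed
  ultimately have "(u, v) \<in> polygon_diagonals C"
    unfolding polygon_diagonals_iff using a b uv by blast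
  then show False using C(3) by blast
qed

lemma cells_glued: "cells V D = cells V1 D1 \<union> cells V2 D2"
proof (intro equalityI subsetI)
  fix C assume cell: "C \<in> cells V D"
  then have C: "C \<subseteq> V" "3 \<le> card C" "polygon_sides C \<subseteq> polygon_sides V \<union> D"
    "polygon_diagonals C \<inter> D = {}"
    unfolding cells_def by auto
  from cell_one_sided[OF cell] show "C \<in> cells V1 D1 \<union> cells V2 D2"
  proof
    assume sub: "C \<subseteq> V1"
    have "(x, y) \<in> polygon_sides V1 \<union> D1" if xy: "(x, y) \<in> polygon_sides C" for x y
    proof -
      have xyC: "x \<in> V1" "y \<in> V1" "x < y" using xy sub by (auto simp: polygon_sides_iff)
      consider "(x, y) \<in> polygon_sides V" | "(x, y) \<in> D" using xy C(3) by blast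
      then show ?thesis
      proof cases
        case 1
        then show ?thesis using xyC by (auto simp: polygon_sides_iff)
      next
        case 2
        then show ?thesis
        proof (cases rule: diagonal_cases)
          case 1
          then show ?thesis using xyC by (auto simp: polygon_sides_iff)
        next
          case 2
          then show ?thesis by simp
        next
          case 3
          then show ?thesis using not_both(2)[OF 3(2) xyC(1,2)] by simp
        qed
      qed
    qed
    then have "polygon_sides C \<subseteq> polygon_sides V1 \<union> D1" by (rule subrelI)
    then have "C \<in> cells V1 D1" using sub C unfolding cells_def by auto
    then show ?thesis by blast
  next
    assume sub: "C \<subseteq> V2"
    have "(x, y) \<in> polygon_sides V2 \<union> D2" if xy: "(x, y) \<in> polygon_sides C" for x y
    proof -
      have xyC: "x \<in> V2" "y \<in> V2" "x < y" using xy sub by (auto simp: polygon_sides_iff)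
      consider "(x, y) \<in> polygon_sides V" | "(x, y) \<in> D" using xy C(3) by blast
      then show ?thesis
      proof cases
        case 1
        then show ?thesis using xyC by (auto simp: polygon_sides_iff)
      next
        case 2
        then show ?thesis
        proof (cases rule: diagonal_cases)
          case 1
          then show ?thesis using xyC by (auto simp: polygon_sides_iff)
        next
          case 2
          then show ?thesis using not_both(1)[OF 2(2) xyC(1,2)] by simp
        next
          case 3
          then show ?thesis by simp
        qed
      qed
    qed
    then have "polygon_sides C \<subseteq> polygon_sides V2 \<union> D2" by (rule subrelI)
    then have "C \<in> cells V2 D2" using sub C unfolding cells_def by auto
    then show ?thesis by blast
  qed
qed (use inner_cell outer_cell in blast)

lemma cells_disjoint: "cells V1 D1 \<inter> cells V2 D2 = {}"
proof -
  have "C \<subseteq> {u, v}" if "C \<subseteq> V1" "C \<subseteq> V2" for C using that by fastforce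
  then have "\<not> 3 \<le> card C" if "C \<subseteq> V1" "C \<subseteq> V2" for C using subset_pair_card that by metis
  then show ?thesis unfolding cells_def by blast
qed

end

section \<open>Words and closed walks\<close>

text \<open>
  A tuple \<open>(a0, \<dots>, am)\<close> of positive integers is encoded as the word
  \<open>Star\<^bsup>a0-1\<^esup> Bar Star\<^bsup>a1-1\<^esup> Bar \<dots> Bar Star\<^bsup>am-1\<^esup>\<close>;
  a polygon with \<open>m + 1\<close> vertices has \<open>m\<close> bars, one for each side other than the side joining the first and the last vertex.
\<close>

datatype letter = Star | Bar

abbreviation bars :: "letter list \<Rightarrow> nat" where "bars w \<equiv> count_list w Bar"

fun entries :: "letter list \<Rightarrow> nat list" where
  "entries [] = [1]"
| "entries (Bar # w) = 1 # entries w"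
| "entries (Star # w) = Suc (hd (entries w)) # tl (entries w)"

text \<open>
  The base case is a single cell with \<open>3 * i + 3\<close> vertices; the other rule glues the polygon of
  \<open>e\<close>, along its side from the first to the last vertex, to the side of the other polygon that is
  marked by \<open>Bar\<close>.
\<close>

inductive_set gluing_words :: "letter list set" where
  base: "replicate (3 * i + 2) Bar \<in> gluing_words"
| glue: "u @ Bar # v \<in> gluing_words \<Longrightarrow> e \<in> gluing_words \<Longrightarrow>
    u @ Star # e @ Star # v \<in> gluing_words"

text \<open>
  Grammar for the closed walks on the Cayley graph of \<open>Z\<^sub>2 * Z\<^sub>3\<close>, a tree of triangles joined by
  edges. Between two consecutive turns in a triangle the walk either stays there (\<open>[Bar]\<close>) or makes
  an excursion across the edge at its current vertex. In the triangle visited by an excursion, the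
  entrance edge must not be crossed before the excursion ends: hence the bare \<open>Bar\<close> in rule \<open>again\<close>.
\<close>

inductive_set gap_words and loop_words where
  bare: "[Bar] \<in> gap_words"
| excursion: "e \<in> loop_words \<Longrightarrow> Star # e @ [Star] \<in> gap_words"
| once: "g \<in> gap_words \<Longrightarrow> h \<in> gap_words \<Longrightarrow> g @ h \<in> loop_words"
| again: "g \<in> gap_words \<Longrightarrow> h \<in> gap_words \<Longrightarrow> e \<in> loop_words \<Longrightarrow> g @ h @ Bar # e \<in> loop_words"

text \<open>These are walks from position 1 to position 0 of the root triangle. The root has no
  entrance, so position 0 may carry an excursion too, and a full round consists of three arbitrary
  gaps.\<close>

inductive_set closed_words where
  last: "g \<in> gap_words \<Longrightarrow> h \<in> gap_words \<Longrightarrow> g @ h \<in> closed_words"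
| more: "g \<in> gap_words \<Longrightarrow> h \<in> gap_words \<Longrightarrow> k \<in> gap_words \<Longrightarrow> w \<in> closed_words \<Longrightarrow>
    g @ h @ k @ w \<in> closed_words"

text \<open>
  A vertex of the Cayley graph is a stack, top first, of positions in the successive triangles on
  the path to it from a root triangle. Position 0 is the entrance of a triangle other than the root.
\<close>

fun turn :: "nat list \<Rightarrow> nat list" where
  "turn [] = []"
| "turn (r # s) = (Suc r mod 3) # s"

fun jump :: "nat list \<Rightarrow> nat list" where
  "jump (r # r' # s) = (if r = 0 then r' # s else 0 # r # r' # s)"
| "jump s = 0 # s"

text \<open>\<open>Star\<close> includes a turn after its jump, so every gap, bare or an excursion,
  advances the position in its triangle by exactly one.\<close>

fun step :: "letter \<Rightarrow> nat list \<Rightarrow> nat list" where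
  "step Bar s = turn s"
| "step Star s = turn (jump s)"

fun run :: "letter list \<Rightarrow> nat list \<Rightarrow> nat list" where
  "run [] s = s"
| "run (x # w) s = run w (step x s)"

text \<open>A position below the top is the one where its triangle was left for a further one. Only
  in the root can this be 0, since elsewhere 0 leads back; \<open>tl\<close> removes the top and
  \<open>butlast\<close> the root.\<close>

definition valid_stack :: "nat list \<Rightarrow> bool" where
  "valid_stack s \<longleftrightarrow> s \<noteq> [] \<and> (\<forall>r\<in>set s. r < 3) \<and> 0 \<notin> set (butlast (tl s))"

section \<open>The action of words on the tree of triangles\<close>

lemma run_append: "run (v @ w) s = run w (run v s)"
  by (induction v arbitrary: s) auto

lemma turn_turn_turn: "valid_stack s \<Longrightarrow> turn (turn (turn s)) = s"
proof (cases s)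
  case (Cons r t)
  moreover assume "valid_stack s"
  ultimately have "r = 0 \<or> r = 1 \<or> r = 2" unfolding valid_stack_def by auto
  then show ?thesis using Cons by auto
qed simp

lemma valid_turn: "valid_stack s \<Longrightarrow> valid_stack (turn s)"
  by (cases s) (auto simp: valid_stack_def)

lemma valid_jump: "valid_stack s \<Longrightarrow> valid_stack (jump s)"
  by (cases s rule: jump.cases) (auto simp: valid_stack_def split: if_splits)

text \<open>After a return, the uncovered position is nonzero or in the root, so the next jump goes
  out again. With \<open>turn_turn_turn\<close> this gives the relations of
  \<open>Z2 * Z3\<close>.\<close>

lemma jump_jump: "valid_stack s \<Longrightarrow> jump (jump s) = s"
proof (cases s rule: jump.cases)
  case (1 r r' s')
  then show "valid_stack s \<Longrightarrow> ?thesis" by (cases s') (auto simp: valid_stack_def)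
qed (auto simp: valid_stack_def)

lemma valid_step: "valid_stack s \<Longrightarrow> valid_stack (step x s)"
  by (cases x) (auto simp: valid_turn valid_jump)

lemma valid_run: "valid_stack s \<Longrightarrow> valid_stack (run w s)"
  by (induction w arbitrary: s) (auto simp: valid_step)

lemma run_bars: "valid_stack s \<Longrightarrow> run (replicate (3 * i) Bar) s = s"
proof (induction i)
  case (Suc i)
  have "replicate (3 * Suc i) Bar = [Bar, Bar, Bar] @ replicate (3 * i) Bar"
    by (simp add: numeral_3_eq_3)
  then show ?case using Suc turn_turn_turn by (simp add: run_append)
qed simp

text \<open>Says that \<open>Bar # w\<close> is a relation. For a single cell it consists of
  \<open>3 * i + 3\<close> turns; in a glued word the turn of the first \<open>Star\<close> cancels
  with \<open>e\<close>, the two jumps cancel, and the turn of the replaced \<open>Bar\<close>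
  remains.\<close>

lemma gluing_words_act_trivially:
  "w \<in> gluing_words \<Longrightarrow> valid_stack s \<Longrightarrow> run w (turn s) = s"
proof (induction arbitrary: s rule: gluing_words.induct)
  case (base i)
  have "replicate (3 * i + 2) Bar = Bar # Bar # replicate (3 * i) Bar" by simp
  then show ?case using base by (simp add: run_bars turn_turn_turn valid_turn)
next
  case (glue u v e)
  let ?s = "run u (turn s)"
  have valid: "valid_stack ?s" using glue.prems by (intro valid_run valid_turn)
  have "run (u @ Star # e @ Star # v) (turn s) = run v (turn (jump (jump ?s)))"
    using glue.IH(2)[of "jump ?s"] valid by (simp add: run_append valid_jump)
  also have "\<dots> = run (u @ Bar # v) (turn s)"
    using valid by (simp add: run_append jump_jump)
  finally show ?case using glue by simp
qed

text \<open>Stack length is depth in the tree. A walk that ends no deeper than it started begins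
  with a gap; one that has just entered a triangle and ends outside it begins with a loop and the
  \<open>Star\<close> that leaves. The two claims need each other, hence the joint
  induction.\<close>

lemma gap_loop_parse:
  "(w \<noteq> [] \<longrightarrow> (r \<noteq> 0 \<or> t = []) \<longrightarrow> length (run w (r # t)) \<le> Suc (length t) \<longrightarrow>
     (\<exists>g\<in>gap_words. \<exists>w'. w = g @ w' \<and> run g (r # t) = (Suc r mod 3) # t)) \<and>
   (length (run w (1 # q # t)) < Suc (Suc (length t)) \<longrightarrow>
     (\<exists>e\<in>loop_words. \<exists>w'. w = e @ Star # w' \<and> run e (1 # q # t) = 0 # q # t))"
proof (induction "length w" arbitrary: w r t q rule: less_induct)
  case less
  have IH_gap: "\<exists>g\<in>gap_words. \<exists>w'. v = g @ w' \<and> run g (r # t) = (Suc r mod 3) # t"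
    if "length v < length w" "v \<noteq> []" "r \<noteq> 0 \<or> t = []" "length (run v (r # t)) \<le> Suc (length t)"
    for v r t
    using less.hyps[of v r t 0] that by blast
  have IH_loop: "\<exists>e\<in>loop_words. \<exists>w'. v = e @ Star # w' \<and> run e (1 # q # t) = 0 # q # t"
    if "length v < length w" "length (run v (1 # q # t)) < Suc (Suc (length t))" for v q t
    using less.hyps[of v 0 t q] that by blast
  \<comment> \<open>The gap claim for \<open>w\<close> uses the loop claim only for a shorter word,
    so it is available below for \<open>w\<close> itself.\<close>
  have gap: "\<exists>g\<in>gap_words. \<exists>w'. w = g @ w' \<and> run g (r # t) = (Suc r mod 3) # t"
    if w: "w \<noteq> []" "r \<noteq> 0 \<or> t = []" "length (run w (r # t)) \<le> Suc (length t)" for r t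
  proof (cases w)
    case (Cons x v)
    show ?thesis
    proof (cases x)
      case Bar
      then show ?thesis using Cons gap_words_loop_words.bare by (auto intro!: bexI[of _ "[Bar]"])
    next
      case Star
      have j: "jump (r # t) = 0 # r # t" using w(2) by (cases t) auto
      then have "length (run v (1 # r # t)) < Suc (Suc (length t))"
        using w(3) Cons Star by simp
      moreover have "length v < length w" using Cons by simp
      ultimately obtain e v' where e: "e \<in> loop_words" "v = e @ Star # v'" "run e (1 # r # t) = 0 # r # t"
        using IH_loop by blast
      have "w = (Star # e @ [Star]) @ v'" using Cons Star e by simp
      moreover have "run (Star # e @ [Star]) (r # t) = (Suc r mod 3) # t"
        using e j by (simp add: run_append)
      ultimately show ?thesis using gap_words_loop_words.excursion[OF e(1)] by blast
    qed
  qed (use w in simp)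
  have loop: "\<exists>e\<in>loop_words. \<exists>w'. w = e @ Star # w' \<and> run e (1 # q # t) = 0 # q # t"
    if h: "length (run w (1 # q # t)) < Suc (Suc (length t))"
  proof -
    have "w \<noteq> []" using h by auto
    then obtain g w1 where g: "g \<in> gap_words" "w = g @ w1" "run g (1 # q # t) = 2 # q # t"
      using gap[of 1 "q # t"] h by (force simp: numeral_2_eq_2)
    have gne: "g \<noteq> []" using g(1) by (auto elim: gap_words.cases)
    have h1: "length (run w1 (2 # q # t)) < Suc (Suc (length t))"
      using h g by (simp add: run_append)
    then have "w1 \<noteq> []" by auto
    moreover have "length w1 < length w" using g(2) gne by simp
    ultimately obtain k w2 where k: "k \<in> gap_words" "w1 = k @ w2" "run k (2 # q # t) = 0 # q # t"
      using IH_gap[of w1 2 "q # t"] h1 by auto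
    have h2: "length (run w2 (0 # q # t)) < Suc (Suc (length t))"
      using h1 k by (simp add: run_append)
    \<comment> \<open>Back at the entrance, \<open>Star\<close> leaves the triangle and
      \<open>Bar\<close> begins another round.\<close>
    then obtain x w3 where w2: "w2 = x # w3" by (cases w2) auto
    show ?thesis
    proof (cases x)
      case Star
      have "run (g @ k) (1 # q # t) = 0 # q # t" using g k by (simp add: run_append)
      moreover have "w = (g @ k) @ Star # w3" using g k w2 Star by simp
      ultimately show ?thesis using gap_words_loop_words.once[OF g(1) k(1)] by blast
    next
      case Bar
      then have "length (run w3 (1 # q # t)) < Suc (Suc (length t))" using h2 w2 by simp
      then obtain e w4 where e: "e \<in> loop_words" "w3 = e @ Star # w4" "run e (1 # q # t) = 0 # q # t"
        using IH_loop[of w3 q t] g k w2 by auto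
      have "w = (g @ k @ Bar # e) @ Star # w4" using g k w2 Bar e by simp
      moreover have "run (g @ k @ Bar # e) (1 # q # t) = 0 # q # t"
        using g k e by (simp add: run_append)
      ultimately show ?thesis using gap_words_loop_words.again[OF g(1) k(1) e(1)] by blast
    qed
  qed
  show ?case using gap loop by blast
qed

lemma gap_parse:
  assumes "w \<noteq> []" "run w [r] = [0]"
  obtains g w' where "g \<in> gap_words" "w = g @ w'" "run w' [Suc r mod 3] = [0]"
proof -
  from assms have "\<exists>g\<in>gap_words. \<exists>w'. w = g @ w' \<and> run g [r] = [Suc r mod 3]"
    using gap_loop_parse[of w r "[]", THEN conjunct1] by simp
  then obtain g w' where "g \<in> gap_words" "w = g @ w'" "run g [r] = [Suc r mod 3]" by blast
  with assms that show thesis by (simp add: run_append)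
qed

lemma gap_words_nonempty: "g \<in> gap_words \<Longrightarrow> g \<noteq> []"
  by (auto elim: gap_words.cases)

text \<open>Each round of the root triangle consumes three gaps; the walk can end only at position
  0, after the second gap of a round.\<close>

lemma closed_parse: "run w [1] = [0] \<Longrightarrow> w \<in> closed_words"
proof (induction "length w" arbitrary: w rule: less_induct)
  case less
  have "w \<noteq> []" using less.prems by auto
  then obtain g w1 where g: "g \<in> gap_words" "w = g @ w1" "run w1 [2] = [0]"
    using gap_parse[OF _ less.prems] by (auto simp: numeral_2_eq_2)
  have "w1 \<noteq> []" using g(3) by auto
  then obtain h w2 where h: "h \<in> gap_words" "w1 = h @ w2" "run w2 [0] = [0]"
    using gap_parse[OF _ g(3)] by auto
  show ?case
  proof (cases "w2 = []")
    case True
    then show ?thesis using g h closed_words.last by simp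
  next
    case False
    then obtain k w3 where k: "k \<in> gap_words" "w2 = k @ w3" "run w3 [1] = [0]"
      using gap_parse[OF _ h(3)] by auto
    have "w3 \<in> closed_words" using less.hyps[OF _ k(3)] g h k gap_words_nonempty by fastforce
    then show ?thesis using closed_words.more[OF g(1) h(1) k(1)] g h k by simp
  qed
qed

text \<open>A loop with \<open>i\<close> extra rounds is a cell with \<open>3 * i + 3\<close>
  vertices, some of whose sides are replaced by gaps. The arbitrary context \<open>u\<close>,
  \<open>v\<close> lets these replacements be made one after another.\<close>

lemma gap_loop_fill:
  "g \<in> gap_words \<Longrightarrow> (\<forall>u v. u @ Bar # v \<in> gluing_words \<longrightarrow> u @ g @ v \<in> gluing_words)"
  "e \<in> loop_words \<Longrightarrow> (\<exists>i. \<forall>u v. u @ replicate (3 * i + 2) Bar @ v \<in> gluing_words \<longrightarrow>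
      u @ e @ v \<in> gluing_words)"
proof (induction rule: gap_words_loop_words.inducts)
  case (excursion e)
  then obtain i where i: "\<And>u v. u @ replicate (3 * i + 2) Bar @ v \<in> gluing_words \<Longrightarrow>
      u @ e @ v \<in> gluing_words" by blast
  \<comment> \<open>With empty context, the block of bars is itself a single cell.\<close>
  have "e \<in> gluing_words" using i[of "[]" "[]"] gluing_words.base[of i] by simp
  then show ?case using gluing_words.glue by simp
next
  case (once g h)
  have "u @ (g @ h) @ v \<in> gluing_words" if "u @ replicate (3 * 0 + 2) Bar @ v \<in> gluing_words" for u v
  proof -
    have "u @ g @ Bar # v \<in> gluing_words"
      using once(3)[rule_format, of u "Bar # v"] that by (simp add: numeral_2_eq_2)
    then show ?thesis using once(4)[rule_format, of "u @ g" v] by simp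
  qed
  then show ?case by blast
next
  case (again g h e)
  then obtain i where i: "\<And>u v. u @ replicate (3 * i + 2) Bar @ v \<in> gluing_words \<Longrightarrow>
      u @ e @ v \<in> gluing_words" by blast
  have "u @ (g @ h @ Bar # e) @ v \<in> gluing_words"
    if "u @ replicate (3 * Suc i + 2) Bar @ v \<in> gluing_words" for u v
  proof -
    have "u @ Bar # (Bar # Bar # replicate (3 * i + 2) Bar @ v) \<in> gluing_words"
      using that by (simp add: numeral_3_eq_3)
    then have "(u @ g) @ Bar # (Bar # replicate (3 * i + 2) Bar @ v) \<in> gluing_words"
      unfolding append_assoc by (rule again.IH(1)[rule_format])
    then have "(u @ g) @ h @ (Bar # replicate (3 * i + 2) Bar @ v) \<in> gluing_words"
      by (rule again.IH(2)[rule_format])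
    then show ?thesis using i[of "u @ g @ h @ [Bar]" v] by simp
  qed
  then show ?case by blast
qed auto

lemma closed_fill:
  "w \<in> closed_words \<Longrightarrow> (\<exists>i. \<forall>u v. u @ replicate (3 * i + 2) Bar @ v \<in> gluing_words \<longrightarrow>
      u @ w @ v \<in> gluing_words)"
proof (induction rule: closed_words.induct)
  case (last g h)
  then show ?case using gap_loop_fill(2)[OF gap_words_loop_words.once] by simp
next
  case (more g h k w)
  then obtain i where i: "\<And>u v. u @ replicate (3 * i + 2) Bar @ v \<in> gluing_words \<Longrightarrow>
      u @ w @ v \<in> gluing_words" by blast
  note fill = more(1-3)[THEN gap_loop_fill(1), rule_format]
  have "u @ (g @ h @ k @ w) @ v \<in> gluing_words"
    if "u @ replicate (3 * Suc i + 2) Bar @ v \<in> gluing_words" for u v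
  proof -
    have "u @ Bar # (Bar # Bar # replicate (3 * i + 2) Bar @ v) \<in> gluing_words"
      using that by (simp add: numeral_3_eq_3)
    then have "(u @ g) @ Bar # (Bar # replicate (3 * i + 2) Bar @ v) \<in> gluing_words"
      unfolding append_assoc by (rule fill(1))
    then have "(u @ g) @ h @ (Bar # replicate (3 * i + 2) Bar @ v) \<in> gluing_words"
      by (rule fill(2))
    then have "(u @ g @ h) @ Bar # (replicate (3 * i + 2) Bar @ v) \<in> gluing_words" by simp
    then have "(u @ g @ h) @ k @ (replicate (3 * i + 2) Bar @ v) \<in> gluing_words"
      by (rule fill(3))
    then show ?thesis using i[of "u @ g @ h @ k" v] by simp
  qed
  then show ?case by blast
qed

text \<open>Gluing can derive a word in several ways, whereas the grammar of closed walks parses it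
  uniquely and so can be counted. Triviality is tested at the root, where \<open>turn [0]\<close> is
  \<open>[1]\<close>.\<close>

lemma gluing_words_eq_closed_words: "gluing_words = closed_words"
proof (intro equalityI subsetI)
  fix w assume "w \<in> gluing_words"
  then have "run w [1] = [0]"
    using gluing_words_act_trivially[of w "[0]"] by (simp add: valid_stack_def)
  then show "w \<in> closed_words" by (rule closed_parse)
next
  fix w assume "w \<in> closed_words"
  then obtain i where "\<And>u v. u @ replicate (3 * i + 2) Bar @ v \<in> gluing_words \<Longrightarrow>
      u @ w @ v \<in> gluing_words" using closed_fill by blast
  from this[of "[]" "[]"] show "w \<in> gluing_words" using gluing_words.base[of i] by simp
qed

section \<open>Quiddities as words\<close>

definition incidence :: "nat set \<Rightarrow> (nat \<times> nat) set \<Rightarrow> nat \<Rightarrow> nat" where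
  "incidence V D i = card {C \<in> cells V D. i \<in> C}"

text \<open>Arbitrary vertex sets are allowed because the halves of a cut polygon are not of the
  form \<open>{0..n+1}\<close>.\<close>

definition quiddity_list :: "nat set \<Rightarrow> (nat \<times> nat) set \<Rightarrow> nat list" where
  "quiddity_list V D = map (incidence V D) (sorted_list_of_set V)"

lemma quiddity_eq_quiddity_list: "quiddity n D = quiddity_list {0..n + 1} D"
proof -
  have "sorted_list_of_set {0..n + 1} = [0..<n + 2]"
    by (metis Suc_eq_plus1 add_2_eq_Suc' atLeastLessThanSuc_atLeastAtMost sorted_list_of_set_range)
  then show ?thesis
    unfolding quiddity_def quiddity_list_def incidence_def by simp
qed

lemma finite_cells: "finite V \<Longrightarrow> finite (cells V D)"
  by (rule finite_subset[of _ "Pow V"]) (auto simp: cells_def)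

lemma incidence_outside: "i \<notin> V \<Longrightarrow> incidence V D i = 0"
proof -
  assume "i \<notin> V"
  then have "{C \<in> cells V D. i \<in> C} = {}" by (auto simp: cells_def)
  then show ?thesis unfolding incidence_def by (metis card.empty)
qed

lemma (in glued_dissections) incidence_glued:
  "incidence V D i = incidence V1 D1 i + incidence V2 D2 i"
proof -
  have "{C \<in> cells V D. i \<in> C} = {C \<in> cells V1 D1. i \<in> C} \<union> {C \<in> cells V2 D2. i \<in> C}"
    unfolding cells_glued by blast
  moreover have "{C \<in> cells V1 D1. i \<in> C} \<inter> {C \<in> cells V2 D2. i \<in> C} = {}"
    using cells_disjoint by blast
  moreover have "finite (cells V1 D1)" "finite (cells V2 D2)" using fin finite_cells by auto
  ultimately show ?thesis unfolding incidence_def by (simp add: card_Un_disjoint)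
qed

lemma (in glued_dissections) three_periodic_glued:
  "three_periodic V D \<longleftrightarrow> three_periodic V1 D1 \<and> three_periodic V2 D2"
  using glued_dissection diss1 diss2 unfolding three_periodic_def cells_glued by blast

text \<open>Only \<open>u\<close> and \<open>v\<close> belong to both halves, so only their entries
  add up. The length of \<open>A\<close> locates the glued side among the bars of a word.\<close>

lemma (in glued_dissections) quiddity_list_glued:
  obtains A a b C c B d where
    "quiddity_list V2 D2 = A @ a # b # C" "quiddity_list V1 D1 = c # B @ [d]"
    "quiddity_list V D = A @ (a + c) # B @ (d + b) # C" "length A = card {x \<in> V. x < u}"
proof -
  let ?A = "{x \<in> V. x < u}" and ?B = "{x \<in> V. u < x \<and> x < v}" and ?C = "{x \<in> V. v < x}"
  let ?s = sorted_list_of_set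
  have fins: "finite ?A" "finite ?B" "finite ?C" using fin by auto
  have sV: "?s V = ?s ?A @ u # ?s ?B @ v # ?s ?C"
    by (rule strict_sorted_equal) (use fin fins uv in \<open>auto simp: sorted_wrt_append\<close>)
  have sV1: "?s V1 = u # ?s ?B @ [v]"
    by (rule strict_sorted_equal) (use fin fins uv in \<open>auto simp: sorted_wrt_append\<close>)
  have sV2: "?s V2 = ?s ?A @ u # v # ?s ?C"
    by (rule strict_sorted_equal) (use fin fins uv in \<open>auto simp: sorted_wrt_append\<close>)
  have out: "incidence V D x = incidence V2 D2 x" if "x \<in> ?A \<union> ?C" for x
    using that incidence_glued incidence_outside[of x V1 D1] by auto
  have inn: "incidence V D x = incidence V1 D1 x" if "x \<in> ?B" for x
    using that incidence_glued incidence_outside[of x V2 D2] by auto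
  show thesis
  proof (rule that)
    show "quiddity_list V2 D2 = map (incidence V2 D2) (?s ?A) @ incidence V2 D2 u # incidence V2 D2 v #
        map (incidence V2 D2) (?s ?C)"
      unfolding quiddity_list_def sV2 by simp
    show "quiddity_list V1 D1 = incidence V1 D1 u # map (incidence V1 D1) (?s ?B) @ [incidence V1 D1 v]"
      unfolding quiddity_list_def sV1 by simp
    have "map (incidence V D) (?s ?A) = map (incidence V2 D2) (?s ?A)"
      "map (incidence V D) (?s ?C) = map (incidence V2 D2) (?s ?C)"
      "map (incidence V D) (?s ?B) = map (incidence V1 D1) (?s ?B)"
      using fins out inn by auto
    then show "quiddity_list V D = map (incidence V2 D2) (?s ?A) @
        (incidence V2 D2 u + incidence V1 D1 u) # map (incidence V1 D1) (?s ?B) @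
        (incidence V1 D1 v + incidence V2 D2 v) # map (incidence V2 D2) (?s ?C)"
      unfolding quiddity_list_def sV using incidence_glued[of u] incidence_glued[of v] by simp
    show "length (map (incidence V2 D2) (?s ?A)) = card ?A" by simp
  qed
qed

section \<open>Decoding words into tuples\<close>

lemma entries_nonempty [simp]: "entries w \<noteq> []" "[] \<noteq> entries w"
  by (induction w rule: entries.induct) auto

lemma length_entries: "length (entries w) = Suc (bars w)"
  by (induction w rule: entries.induct) auto

lemma entries_Bar: "entries (u @ Bar # v) = entries u @ entries v"
  by (induction u rule: entries.induct) auto

text \<open>Runs of \<open>i\<close> and \<open>j\<close> stars joined by a \<open>Star\<close>
  encode \<open>i + 1 + j + 1\<close>, the sum of the entries \<open>i + 1\<close> and
  \<open>j + 1\<close>; this is how gluing adds entries.\<close>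

lemma entries_Star:
  "entries (u @ Star # v) = butlast (entries u) @ (last (entries u) + hd (entries v)) # tl (entries v)"
proof (induction u rule: entries.induct)
  case (3 w)
  then show ?case by (cases "entries w" rule: list.exhaust; cases "tl (entries w)") auto
qed auto

lemma hd_entries_pos: "0 < hd (entries w)"
  by (induction w rule: entries.induct) auto

text \<open>The first entry exceeds 1 exactly if the word begins with \<open>Star\<close>; otherwise
  the length of the tuple tells \<open>[]\<close> from an initial \<open>Bar\<close>.\<close>

lemma entries_inject: "entries w = entries w' \<Longrightarrow> w = w'"
proof (induction w arbitrary: w' rule: entries.induct)
  case 1
  then show ?case using hd_entries_pos[of "tl w'"] by (cases w' rule: entries.cases) auto
next
  case (2 w)
  then show ?case using hd_entries_pos[of "tl w'"] by (cases w' rule: entries.cases) auto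
next
  case (3 w)
  show ?case
  proof (cases w' rule: entries.cases)
    case (3 w'')
    then have "hd (entries w) = hd (entries w'')" "tl (entries w) = tl (entries w'')"
      using \<open>entries (Star # w) = entries w'\<close> by auto
    then show ?thesis using 3 "3.IH" by (simp add: list.expand)
  qed (use \<open>entries (Star # w) = entries w'\<close> hd_entries_pos[of w] in auto)
qed

lemma entries_glue:
  assumes "entries (p @ Bar # q) = A @ a # b # C" "length A = bars p" "entries e = c # B @ [d]"
  shows "entries (p @ Star # e @ Star # q) = A @ (a + c) # B @ (d + b) # C"
proof -
  have "entries p @ entries q = (A @ [a]) @ (b # C)" using assms(1) by (simp add: entries_Bar)
  moreover have "length (entries p) = length (A @ [a])" using assms(2) by (simp add: length_entries)
  ultimately have "entries p = A @ [a]" "entries q = b # C"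
    by (metis append_eq_append_conv)+
  then show ?thesis by (simp add: entries_Star assms(3))
qed

lemma split_at_bar:
  "k < bars w \<Longrightarrow> \<exists>p q. w = p @ Bar # q \<and> bars p = k"
proof (induction w arbitrary: k)
  case (Cons x w)
  show ?case
  proof (cases x)
    case Star
    then obtain p q where "w = p @ Bar # q" "bars p = k" using Cons.IH[of k] Cons.prems by auto
    then show ?thesis using Star by (intro exI[of _ "Star # p"] exI[of _ q]) auto
  next
    case Bar
    show ?thesis
    proof (cases k)
      case 0
      then show ?thesis using Bar by (intro exI[of _ "[]"] exI[of _ w]) auto
    next
      case (Suc j)
      then obtain p q where "w = p @ Bar # q" "bars p = j" using Cons.IH[of j] Cons.prems Bar by auto
      then show ?thesis using Bar Suc by (intro exI[of _ "Bar # p"] exI[of _ q]) auto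
    qed
  qed
qed simp

lemma bars_replicate [simp]: "bars (replicate m Bar) = m"
  by (induction m) auto

lemma entries_bars: "entries (replicate m Bar) = replicate (Suc m) 1"
  by (induction m) auto

lemma bars_gluing_words: "w \<in> gluing_words \<Longrightarrow> 2 \<le> bars w"
  by (induction rule: gluing_words.induct) (auto simp: count_list_append)

lemma quiddity_list_empty:
  assumes "finite V" "card V = Suc m" "2 \<le> m"
  shows "quiddity_list V {} = entries (replicate m Bar)"
proof -
  have c: "cells V {} = {V}" using assms by (intro cells_empty) auto
  have "incidence V {} i = 1" if "i \<in> V" for i
  proof -
    have "{C \<in> cells V {}. i \<in> C} = {V}" using that c by auto
    then show ?thesis unfolding incidence_def by simp
  qed
  then have "quiddity_list V {} = map (\<lambda>_. 1) (sorted_list_of_set V)"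
    unfolding quiddity_list_def using assms by auto
  then show ?thesis using assms by (simp add: entries_bars map_replicate_const del: replicate_Suc)
qed

text \<open>Cutting along any diagonal leaves two smaller 3-periodic dissections; without diagonals
  the whole polygon is the only cell.\<close>

lemma three_periodic_quiddity_list:
  assumes "finite V" "3 \<le> card V" "three_periodic V D"
  shows "\<exists>w\<in>gluing_words. quiddity_list V D = entries w"
  using assms
proof (induction "card V" arbitrary: V D rule: less_induct)
  case less
  have diss: "dissection V D" using less.prems unfolding three_periodic_def by blast
  show ?case
  proof (cases "D = {}")
    case True
    then have "3 dvd card V"
      using less.prems cells_empty[of V] unfolding three_periodic_def by auto
    then obtain j where "card V = 3 * j" by blast
    then obtain i where "card V = 3 * Suc i" using less.prems(2) by (cases j) auto
    then have i: "card V = Suc (3 * i + 2)" by simp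
    then have "quiddity_list V D = entries (replicate (3 * i + 2) Bar)"
      using quiddity_list_empty[OF less.prems(1) i] True by simp
    then show ?thesis using gluing_words.base by blast
  next
    case False
    then obtain u v where uvD: "(u, v) \<in> D" by auto
    obtain D1 D2 where D12: "dissection (V \<inter> {u..v}) D1" "dissection (V - {u<..<v}) D2"
      "D = insert (u, v) (D1 \<union> D2)"
      using dissection_split[OF diss uvD] by blast
    have "(u, v) \<in> polygon_diagonals V" using diss uvD unfolding dissection_def by blast
    with D12(1,2) less.prems(1) interpret glued_dissections V u v D1 D2
      by unfold_locales
    obtain z z' where z: "u \<in> V" "v \<in> V" "u < v" "z \<in> V" "u < z" "z < v" "z' \<in> V" "z' < u \<or> v < z'"
      using diagonal unfolding polygon_diagonals_iff by blast
    \<comment> \<open>The vertices on either side of \<open>(u, v)\<close> give each half a third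
      vertex and make it a proper subset.\<close>
    have "{u, z, v} \<subseteq> V1" "{u, v, z'} \<subseteq> V2" "card {u, z, v} = 3" "card {u, v, z'} = 3"
      using z by auto
    then have ge: "3 \<le> card V1" "3 \<le> card V2"
      using fin card_mono[of V1 "{u, z, v}"] card_mono[of V2 "{u, v, z'}"] by auto
    have "z' \<notin> V1" "z \<notin> V2" using z by auto
    then have "V1 \<subset> V" "V2 \<subset> V" using z by blast+
    then have less: "card V1 < card V" "card V2 < card V" using fin psubset_card_mono by blast+
    have "three_periodic V1 D1" "three_periodic V2 D2"
      using less.prems(3) D12(3) three_periodic_glued by auto
    then obtain e w where e: "e \<in> gluing_words" "quiddity_list V1 D1 = entries e"
      and w: "w \<in> gluing_words" "quiddity_list V2 D2 = entries w"
      using less.hyps[OF less(1) _ ge(1)] less.hyps[OF less(2) _ ge(2)] fin by blast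
    obtain A a b C c B d where q: "quiddity_list V2 D2 = A @ a # b # C" "quiddity_list V1 D1 = c # B @ [d]"
      "quiddity_list V (insert (u, v) (D1 \<union> D2)) = A @ (a + c) # B @ (d + b) # C"
      by (rule quiddity_list_glued)
    have "length A < bars w" using q(1) w(2) length_entries[of w] by simp
    then obtain p r where p: "w = p @ Bar # r" "bars p = length A" using split_at_bar by blast
    then have "quiddity_list V D = entries (p @ Star # e @ Star # r)"
      using q e w D12(3) entries_glue[of p r A a b C e c B d] by simp
    then show ?thesis using gluing_words.glue p e w by blast
  qed
qed

text \<open>The claim covers every vertex set of the right size, so that the induction hypotheses
  apply to the two halves.\<close>

lemma gluing_word_realized:
  assumes "w \<in> gluing_words" "finite V" "card V = Suc (bars w)"
  shows "\<exists>D. three_periodic V D \<and> quiddity_list V D = entries w"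
  using assms
proof (induction arbitrary: V rule: gluing_words.induct)
  case (base i)
  then have V: "card V = Suc (3 * i + 2)" by simp
  then have "cells V {} = {V}" using base by (intro cells_empty) auto
  moreover have "3 dvd card V" using V by presburger
  ultimately have "three_periodic V {}"
    unfolding three_periodic_def dissection_def by auto
  then show ?case using quiddity_list_empty[OF _ V] base by auto
next
  case (glue p q e)
  have e2: "2 \<le> bars e" and pq: "1 \<le> bars p + bars q"
    using bars_gluing_words glue.hyps by (fastforce simp: count_list_append)+
  define L where "L = sorted_list_of_set V"
  have L: "set L = V" "sorted_wrt (<) L" "length L = card V"
    unfolding L_def using glue.prems by auto
  have len: "length L = Suc (bars p + bars e + bars q)"
    using glue.prems L by (simp add: count_list_append)
  define A where "A = take (bars p) L"
  \<comment> \<open>The polygon of \<open>e\<close> has \<open>bars e + 1\<close> vertices, so its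
    base joins the vertices \<open>u\<close> and \<open>v\<close> of index \<open>bars p\<close> and
    \<open>bars p + bars e\<close> in \<open>L\<close>.\<close>
  define u where "u = L ! bars p"
  define L' where "L' = drop (Suc (bars p)) L"
  define B where "B = take (bars e - 1) L'"
  define v where "v = L' ! (bars e - 1)"
  define C where "C = drop (bars e) L'"
  have "L = A @ u # L'" unfolding A_def u_def L'_def using len e2 by (intro id_take_nth_drop) simp
  moreover have "L' = B @ v # drop (Suc (bars e - 1)) L'"
    unfolding B_def v_def by (intro id_take_nth_drop) (use len e2 in \<open>simp add: L'_def\<close>)
  ultimately have LL: "L = A @ u # B @ v # C" using e2 by (simp add: C_def)
  have lens: "length A = bars p" "length B = bars e - 1" "length C = bars q"
    unfolding A_def B_def C_def L'_def using len e2 by auto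
  have ord: "\<And>x. x \<in> set A \<Longrightarrow> x < u" "\<And>x. x \<in> set B \<Longrightarrow> u < x \<and> x < v"
    "\<And>x. x \<in> set C \<Longrightarrow> v < x" "u < v" "distinct L"
    using L(2) LL strict_sorted_iff[of L] by (auto simp: sorted_wrt_append)
  have V: "V = set A \<union> {u} \<union> set B \<union> {v} \<union> set C" using L(1) LL by auto
  have Vless: "{x \<in> V. x < u} = set A"
    unfolding V using ord(1-4) by (auto dest: ord(2,3))
  have V1: "V \<inter> {u..v} = set (u # B @ [v])"
    unfolding V using ord(1-4) by (auto dest: ord(1-3) intro: less_imp_le) 
  have V2: "V - {u<..<v} = set (A @ u # v # C)"
    unfolding V using ord(1-4) by (auto dest: ord(1-3)) 
  have "card (V \<inter> {u..v}) = Suc (bars e)"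
    unfolding V1 using LL ord(5) lens e2 by (subst distinct_card) auto
  then obtain D1 where D1: "three_periodic (V \<inter> {u..v}) D1" "quiddity_list (V \<inter> {u..v}) D1 = entries e"
    using glue.IH(2)[of "V \<inter> {u..v}"] glue.prems by auto
  have "card (V - {u<..<v}) = Suc (bars (p @ Bar # q))"
    unfolding V2 using LL ord(5) lens by (subst distinct_card) (auto simp: count_list_append)
  then obtain D2 where D2: "three_periodic (V - {u<..<v}) D2"
    "quiddity_list (V - {u<..<v}) D2 = entries (p @ Bar # q)"
    using glue.IH(1)[of "V - {u<..<v}"] glue.prems by auto
  \<comment> \<open>Since gluing words have at least two bars, there are vertices on both sides of
    \<open>(u, v)\<close>, which is thus a genuine diagonal.\<close>
  have "B \<noteq> []" "A \<noteq> [] \<or> C \<noteq> []" using lens e2 pq by auto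
  then have "hd B \<in> set B" "(\<exists>z\<in>set A. z < u) \<or> (\<exists>z\<in>set C. v < z)"
    using ord(1,3) by (auto simp: neq_Nil_conv)
  then have "\<exists>z\<in>V. u < z \<and> z < v" "\<exists>z\<in>V. z < u \<or> v < z"
    unfolding V using ord(2) by auto
  then have "(u, v) \<in> polygon_diagonals V"
    unfolding polygon_diagonals_iff using ord(4) V by simp
  then interpret glued_dissections V u v D1 D2
    using D1 D2 glue.prems unfolding three_periodic_def by unfold_locales auto
  obtain A' a b C' c B' d where q: "quiddity_list V2 D2 = A' @ a # b # C'"
    "quiddity_list V1 D1 = c # B' @ [d]"
    "quiddity_list V D = A' @ (a + c) # B' @ (d + b) # C'" "length A' = card {x \<in> V. x < u}"
    by (rule quiddity_list_glued)
  have "length A' = bars p"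
    using q(4) Vless lens(1) ord(5) LL by (simp add: distinct_card)
  then have "quiddity_list V D = entries (p @ Star # e @ Star # q)"
    using q D1 D2 entries_glue[of p q A' a b C' e c B' d] by simp
  then show ?case using three_periodic_glued D1 D2 by blast
qed

lemma Q_eq_card_closed_words:
  assumes "0 < n"
  shows "Q n = card {w \<in> closed_words. bars w = Suc n}"
proof -
  have "{quiddity n D | D. three_periodic {0..n+1} D} = entries ` {w \<in> gluing_words. bars w = Suc n}"
  proof (intro equalityI subsetI)
    fix a assume "a \<in> {quiddity n D | D. three_periodic {0..n+1} D}"
    then obtain D where D: "a = quiddity_list {0..n+1} D" "three_periodic {0..n+1} D"
      by (auto simp: quiddity_eq_quiddity_list)
    then obtain w where w: "w \<in> gluing_words" "a = entries w"
      using three_periodic_quiddity_list[of "{0..n+1}" D] assms by auto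
    have "length a = n + 2" using D(1) unfolding quiddity_list_def by simp
    then show "a \<in> entries ` {w \<in> gluing_words. bars w = Suc n}"
      using w length_entries[of w] by auto
  next
    fix a assume "a \<in> entries ` {w \<in> gluing_words. bars w = Suc n}"
    then obtain w where w: "a = entries w" "w \<in> gluing_words" "bars w = Suc n" by blast
    then show "a \<in> {quiddity n D | D. three_periodic {0..n+1} D}"
      using gluing_word_realized[of w "{0..n+1}"]
      by (simp add: quiddity_eq_quiddity_list) (metis (no_types))
  qed
  then have "Q n = card (entries ` {w \<in> gluing_words. bars w = Suc n})"
    unfolding Q_def by simp
  also have "\<dots> = card {w \<in> gluing_words. bars w = Suc n}"
    by (intro card_image inj_onI entries_inject)
  finally show ?thesis by (simp add: gluing_words_eq_closed_words)
qed

section \<open>Generating functions of words\<close>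

definition bars_gf :: "letter list set \<Rightarrow> real fps" where
  "bars_gf L = Abs_fps (\<lambda>n. real (card {w \<in> L. bars w = n}))"

text \<open>Makes the words with a given number of bars finite in number, so that
  \<open>card\<close> in \<open>bars_gf\<close> really counts them.\<close>

definition star_bounded :: "letter list set \<Rightarrow> bool" where
  "star_bounded L \<longleftrightarrow> (\<forall>w\<in>L. count_list w Star \<le> 2 * bars w)"

definition conc :: "letter list set \<Rightarrow> letter list set \<Rightarrow> letter list set" where
  "conc A B = {a @ b | a b. a \<in> A \<and> b \<in> B}"

lemma length_eq_count: "length w = count_list w Star + bars w"
proof (induction w)
  case (Cons x w)
  then show ?case by (cases x) auto
qed simp

lemma star_bounded_finite:
  assumes "star_bounded L"
  shows "finite {w \<in> L. bars w = n}"
proof -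
  have "{w \<in> L. bars w = n} \<subseteq> {w. set w \<subseteq> {Star, Bar} \<and> length w \<le> 3 * n}"
    using assms letter.exhaust unfolding star_bounded_def by (force simp: length_eq_count)
  then show ?thesis
    using finite_lists_length_le[of "{Star, Bar}" "3 * n"] finite_subset by blast
qed

lemma star_bounded_conc: "star_bounded A \<Longrightarrow> star_bounded B \<Longrightarrow> star_bounded (conc A B)"
  unfolding star_bounded_def conc_def by (fastforce simp: count_list_append)

lemma bars_gf_nth: "fps_nth (bars_gf L) n = real (card {w \<in> L. bars w = n})"
  by (simp add: bars_gf_def)

text \<open>Unique factorization makes the words of the concatenation correspond to pairs, and bars
  add up: a Cauchy product.\<close>

lemma bars_gf_conc:
  assumes A: "star_bounded A" and B: "star_bounded B"
    and unique: "\<And>a a' b b'. \<lbrakk>a \<in> A; a' \<in> A; b \<in> B; b' \<in> B; a @ b = a' @ b'\<rbrakk> \<Longrightarrow> a = a'"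
  shows "bars_gf (conc A B) = bars_gf A * bars_gf B"
proof (rule fps_ext)
  fix n
  let ?A = "\<lambda>i. {a \<in> A. bars a = i}" and ?B = "\<lambda>i. {b \<in> B. bars b = i}"
  let ?S = "\<Union>i\<in>{0..n}. ?A i \<times> ?B (n - i)"
  have fin: "finite (?A i)" "finite (?B i)" for i
    using A B star_bounded_finite by auto
  have "{w \<in> conc A B. bars w = n} = (\<lambda>(a, b). a @ b) ` ?S"
    unfolding conc_def by (force simp: count_list_append image_iff)
  moreover have "inj_on (\<lambda>(a, b). a @ b) ?S"
  proof (rule inj_onI, clarify)
    fix a b a' b'
    assume "a \<in> A" "a' \<in> A" "b \<in> B" "b' \<in> B" and eq: "a @ b = a' @ b'"
    then have "a = a'" by (rule unique)
    then show "a = a' \<and> b = b'" using eq by simp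
  qed
  ultimately have "card {w \<in> conc A B. bars w = n} = card ?S"
    by (simp add: card_image)
  also have "\<dots> = (\<Sum>i=0..n. card (?A i \<times> ?B (n - i)))"
    using fin by (intro card_UN_disjoint) auto
  finally show "fps_nth (bars_gf (conc A B)) n = fps_nth (bars_gf A * bars_gf B) n"
    by (simp add: bars_gf_nth fps_mult_nth card_cartesian_product)
qed

lemma bars_gf_Un:
  assumes "star_bounded A" "star_bounded B" "A \<inter> B = {}"
  shows "bars_gf (A \<union> B) = bars_gf A + bars_gf B"
proof (rule fps_ext)
  fix n
  have "{w \<in> A \<union> B. bars w = n} = {w \<in> A. bars w = n} \<union> {w \<in> B. bars w = n}"
    "{w \<in> A. bars w = n} \<inter> {w \<in> B. bars w = n} = {}" using assms(3) by auto
  then show "fps_nth (bars_gf (A \<union> B)) n = fps_nth (bars_gf A + bars_gf B) n"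
    using assms star_bounded_finite by (simp add: bars_gf_nth card_Un_disjoint)
qed

lemma bars_gf_Bar: "bars_gf {[Bar]} = fps_X"
proof (rule fps_ext)
  fix n
  have "{w \<in> {[Bar]}. bars w = n} = (if n = 1 then {[Bar]} else {})" by auto
  then show "fps_nth (bars_gf {[Bar]}) n = fps_nth fps_X n"
    by (simp add: bars_gf_nth fps_X_def)
qed

lemma bars_gf_excursions: "bars_gf ((\<lambda>e. Star # e @ [Star]) ` L) = bars_gf L"
proof (rule fps_ext)
  fix n
  have "{w \<in> (\<lambda>e. Star # e @ [Star]) ` L. bars w = n} = (\<lambda>e. Star # e @ [Star]) ` {w \<in> L. bars w = n}"
    by (auto simp: count_list_append)
  then show "fps_nth (bars_gf ((\<lambda>e. Star # e @ [Star]) ` L)) n = fps_nth (bars_gf L) n"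
    by (simp add: bars_gf_nth card_image inj_on_def)
qed

text \<open>The slack of 4 for loops pays for the two stars of an excursion and leaves the slack of
  2 for gaps, two of which restore 4.\<close>

lemma stars_gap_loop:
  "g \<in> gap_words \<Longrightarrow> count_list g Star + 2 \<le> 2 * bars g"
  "e \<in> loop_words \<Longrightarrow> count_list e Star + 4 \<le> 2 * bars e"
  by (induction rule: gap_words_loop_words.inducts) (auto simp: count_list_append)

lemma stars_closed: "w \<in> closed_words \<Longrightarrow> count_list w Star + 4 \<le> 2 * bars w"
  by (induction rule: closed_words.induct) (auto simp: count_list_append dest!: stars_gap_loop(1))

lemma star_bounded_words:
  "star_bounded gap_words" "star_bounded loop_words" "star_bounded closed_words"
  "star_bounded {[Bar]}" "star_bounded ((\<lambda>e. Star # e @ [Star]) ` loop_words)"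
  unfolding star_bounded_def using stars_gap_loop stars_closed by (fastforce simp: count_list_append)+

text \<open>Gaps form a prefix code. A loop may be a proper prefix of another, continued by
  \<open>Bar\<close>, so loops are compared only with the \<open>Star\<close> that ends
  them.\<close>

lemma gap_loop_unique:
  "g \<in> gap_words \<Longrightarrow> \<forall>h\<in>gap_words. \<forall>x y. g @ x = h @ y \<longrightarrow> g = h"
  "e \<in> loop_words \<Longrightarrow> \<forall>f\<in>loop_words. \<forall>x y. e @ Star # x = f @ Star # y \<longrightarrow> e = f"
proof (induction rule: gap_words_loop_words.inducts)
  case bare
  then show ?case by (auto elim: gap_words.cases)
next
  case (excursion e)
  show ?case
  proof (intro ballI allI impI)
    fix h x y assume "h \<in> gap_words" and eq: "(Star # e @ [Star]) @ x = h @ y"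
    then show "Star # e @ [Star] = h"
    proof cases
      case (excursion f)
      then have "e @ Star # x = f @ Star # y" using eq by simp
      then show ?thesis using excursion \<open>\<forall>f\<in>loop_words. _ f\<close> by blast
    qed (use eq in simp)
  qed
next
  case (once g h)
  show ?case
  proof (intro ballI allI impI)
    fix f x y assume "f \<in> loop_words" and eq: "(g @ h) @ Star # x = f @ Star # y"
    then show "g @ h = f"
    proof cases
      case l: (once g' h')
      then have "g = g'" using once.IH(1) eq by (metis append_assoc)
      then have "h @ Star # x = h' @ Star # y" using eq l by simp
      then show ?thesis using once.IH(2) l \<open>g = g'\<close> by blast
    next
      case l: (again g' h' f')
      then have "g = g'" using once.IH(1) eq by (metis append_assoc)
      then have "h @ Star # x = h' @ Bar # f' @ Star # y" using eq l by simp
      \<comment> \<open>After cancellation \<open>Star\<close> would have to equal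
        \<open>Bar\<close>, so this case is contradictory.\<close>
      moreover from this have "h = h'" using once.IH(2) l by blast
      ultimately show ?thesis by simp
    qed
  qed
next
  case (again g h e)
  show ?case
  proof (intro ballI allI impI)
    fix f x y assume "f \<in> loop_words" and eq: "(g @ h @ Bar # e) @ Star # x = f @ Star # y"
    then show "g @ h @ Bar # e = f"
    proof cases
      case l: (once g' h')
      then have "g = g'" using again.IH(1) eq by (metis append_assoc)
      then have "h @ Bar # e @ Star # x = h' @ Star # y" using eq l by simp
      moreover from this have "h = h'" using again.IH(2) l by blast
      ultimately show ?thesis by simp
    next
      case l: (again g' h' f')
      then have "g = g'" using again.IH(1) eq by (metis append_assoc)
      then have eq': "h @ Bar # e @ Star # x = h' @ Bar # f' @ Star # y" using eq l by simp
      then have "h = h'" using again.IH(2) l by blast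
      then have "e = f'" using eq' again.IH(3) l by simp blast
      then show ?thesis using l \<open>g = g'\<close> \<open>h = h'\<close> by simp
    qed
  qed
qed

lemma gap_unique:
  "g \<in> gap_words \<Longrightarrow> h \<in> gap_words \<Longrightarrow> g @ x = h @ y \<Longrightarrow> g = h \<and> x = y"
  using gap_loop_unique(1) by blast

lemma bars_gf_conc_gap:
  "star_bounded B \<Longrightarrow> bars_gf (conc gap_words B) = bars_gf gap_words * bars_gf B"
  using gap_unique star_bounded_words(1) by (intro bars_gf_conc) blast+

lemma gap_words_gf: "bars_gf gap_words = fps_X + bars_gf loop_words"
proof -
  let ?E = "(\<lambda>e. Star # e @ [Star]) ` loop_words"
  have "gap_words = {[Bar]} \<union> ?E"
    by (auto elim: gap_words.cases intro: gap_words_loop_words.intros)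
  moreover have "bars_gf ({[Bar]} \<union> ?E) = bars_gf {[Bar]} + bars_gf ?E"
    by (intro bars_gf_Un star_bounded_words) auto
  ultimately show ?thesis by (simp add: bars_gf_Bar bars_gf_excursions)
qed

text \<open>The two rules produce disjoint languages: cancelling both gaps would equate the empty
  word with one beginning with \<open>Bar\<close>.\<close>

lemma loop_words_gf:
  "bars_gf loop_words = bars_gf gap_words ^ 2 * (1 + fps_X * bars_gf loop_words)"
proof -
  let ?A = "conc gap_words gap_words"
    and ?B = "conc gap_words (conc gap_words (conc {[Bar]} loop_words))"
  have "loop_words = ?A \<union> ?B"
  proof (intro equalityI subsetI)
    fix e assume "e \<in> loop_words"
    then show "e \<in> ?A \<union> ?B"
    proof cases
      case (again g h f)
      have "Bar # f = [Bar] @ f" by simp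
      with again show ?thesis unfolding conc_def by blast
    qed (auto simp: conc_def)
  qed (auto simp: conc_def intro: gap_words_loop_words.intros)
  moreover have "?A \<inter> ?B = {}"
  proof -
    have False if wA: "w \<in> ?A" and wB: "w \<in> ?B" for w
    proof -
      obtain g h where w: "w = g @ h" "g \<in> gap_words" "h \<in> gap_words"
        using wA by (auto simp: conc_def)
      obtain g' h' e where w': "w = g' @ h' @ [Bar] @ e" "g' \<in> gap_words" "h' \<in> gap_words"
        using wB by (auto simp: conc_def)
      have "h @ [] = h' @ [Bar] @ e" using gap_unique[of g g' h] w w' by simp
      then show False using gap_unique[of h h' "[]"] w w' by blast
    qed
    then show ?thesis by blast
  qed
  moreover have "bars_gf (conc {[Bar]} loop_words) = fps_X * bars_gf loop_words"
    using star_bounded_words by (subst bars_gf_conc) (auto simp: bars_gf_Bar)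
  moreover have "bars_gf (?A \<union> ?B) = bars_gf ?A + bars_gf ?B" if "?A \<inter> ?B = {}"
    using that by (intro bars_gf_Un star_bounded_conc star_bounded_words)
  moreover have "bars_gf ?A = bars_gf gap_words * bars_gf gap_words"
    by (intro bars_gf_conc_gap star_bounded_words)
  moreover have "bars_gf ?B = bars_gf gap_words * (bars_gf gap_words * bars_gf (conc {[Bar]} loop_words))"
    by (simp add: bars_gf_conc_gap star_bounded_conc star_bounded_words)
  ultimately show ?thesis by (simp add: power2_eq_square algebra_simps)
qed

lemma closed_words_gf:
  "bars_gf closed_words = bars_gf gap_words ^ 2 + bars_gf gap_words ^ 3 * bars_gf closed_words"
proof -
  let ?A = "conc gap_words gap_words"
    and ?B = "conc gap_words (conc gap_words (conc gap_words closed_words))"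
  have "closed_words = ?A \<union> ?B"
  proof (intro equalityI subsetI)
    fix w assume "w \<in> closed_words"
    then show "w \<in> ?A \<union> ?B" by cases (unfold conc_def, blast+)
  qed (auto simp: conc_def intro: closed_words.intros)
  moreover have "?A \<inter> ?B = {}"
  proof -
    have False if wA: "w \<in> ?A" and wB: "w \<in> ?B" for w
    proof -
      obtain g h where w: "w = g @ h" "g \<in> gap_words" "h \<in> gap_words"
        using wA by (auto simp: conc_def)
      obtain g' h' k r where w': "w = g' @ h' @ k @ r" "g' \<in> gap_words" "h' \<in> gap_words"
        "k \<in> gap_words"
        using wB by (auto simp: conc_def)
      have "h @ [] = h' @ k @ r" using gap_unique[of g g' h] w w' by simp
      then show False using gap_unique[of h h' "[]"] gap_words_nonempty w w' by blast
    qed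
    then show ?thesis by blast
  qed
  moreover have "bars_gf (?A \<union> ?B) = bars_gf ?A + bars_gf ?B" if "?A \<inter> ?B = {}"
    using that by (intro bars_gf_Un star_bounded_conc star_bounded_words)
  moreover have "bars_gf ?A = bars_gf gap_words * bars_gf gap_words"
    by (intro bars_gf_conc_gap star_bounded_words)
  moreover have "bars_gf ?B = bars_gf gap_words * (bars_gf gap_words * (bars_gf gap_words * bars_gf closed_words))"
    by (simp add: bars_gf_conc_gap star_bounded_conc star_bounded_words)
  ultimately show ?thesis by (simp add: power2_eq_square power3_eq_cube algebra_simps)
qed

section \<open>Powers of the series\<close>

text \<open>
  The coefficient of \<open>z\<^sup>m t\<^sup>s\<close> in \<open>P\<^sup>r\<close> when \<open>P = 1 + z P\<^sup>2 / (1 - t P\<^sup>2)\<close>, as given by Lagrange inversion. The case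
  \<open>m = 0\<close> is separate because \<open>m - 1\<close> would be truncated.
\<close>

definition lagrange_coeff :: "nat \<Rightarrow> nat \<Rightarrow> nat \<Rightarrow> real" where
  "lagrange_coeff r m s =
     (if m = 0 then (if s = 0 then 1 else 0)
      else real r * fact (m + s - 1) * fact (2 * m + 2 * s + r - 1) /
        (fact s * fact (m - 1) * fact m * fact (m + 2 * s + r)))"

lemma lagrange_coeff_0: "lagrange_coeff 0 m s = (if m = 0 \<and> s = 0 then 1 else 0)"
  by (simp add: lagrange_coeff_def)

text \<open>Multiplying \<open>(P - 1) * (1 - t * P^2) = z * P^2\<close> by \<open>P^r\<close>
  relates the powers of \<open>P\<close>; this is the resulting relation for the coefficients free
  of \<open>t\<close>.\<close>

lemma lagrange_coeff_rec_s0: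
  "lagrange_coeff (Suc r) (Suc m) 0 - lagrange_coeff r (Suc m) 0 = lagrange_coeff (r + 2) m 0"
proof (cases m)
  case 0
  have "lagrange_coeff q 1 0 = real q" for q
    by (simp add: lagrange_coeff_def del: fact_Suc)
  then show ?thesis using 0 by (simp add: lagrange_coeff_def[of _ 0])
next
  case (Suc m')
  define B :: real where "B = fact (2 * m + r + 1)"
  define C :: real where "C = fact (m + r + 1)"
  define M :: real where "M = fact m"
  have nz: "B \<noteq> 0" "C \<noteq> 0" "M \<noteq> 0" unfolding B_def C_def M_def by auto
  have f: "fact (2 * m + r + 2) = (2 * real m + real r + 2) * B"
    "fact (m + r + 2) = (real m + real r + 2) * C"
    "fact (Suc m) = (real m + 1) * M"
    unfolding B_def C_def M_def by (simp_all add: algebra_simps)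
  have *: "x * B / (q * M * (c * C)) - y * B / (q * M * C) = z * B / (M * (c * C))"
    if "x - y * c = z * q" "c > 0" "q > 0" for x y z c q :: real
  proof -
    have "x * B / (q * M * (c * C)) - y * B / (q * M * C) = (x - y * c) * B / (q * M * (c * C))"
      using that nz by (simp add: field_simps)
    then show ?thesis using that nz by (simp add: field_simps)
  qed
  have "lagrange_coeff (Suc r) (Suc m) 0 =
      (real r + 1) * (2 * real m + real r + 2) * B / ((real m + 1) * M * ((real m + real r + 2) * C))"
    using f nz unfolding M_def 
    by (simp add: lagrange_coeff_def numeral_2_eq_2 mult_ac add_ac del: fact_Suc)
  moreover have "lagrange_coeff r (Suc m) 0 = real r * B / ((real m + 1) * M * C)"
    using f nz unfolding M_def B_def C_def by (simp add: lagrange_coeff_def del: fact_Suc)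
  moreover have "lagrange_coeff (r + 2) m 0 = (real r + 2) * B / (M * ((real m + real r + 2) * C))"
    using f nz Suc unfolding M_def B_def by (simp add: lagrange_coeff_def add.assoc del: fact_Suc)
  moreover have "(real r + 1) * (2 * real m + real r + 2) * B / ((real m + 1) * M * ((real m + real r + 2) * C)) -
      real r * B / ((real m + 1) * M * C) = (real r + 2) * B / (M * ((real m + real r + 2) * C))"
    by (rule * ) (simp_all add: algebra_simps)
  ultimately show ?thesis by simp
qed

text \<open>The same relation at a positive power of \<open>t\<close>. Dividing by the common factor
  \<open>K\<close> leaves a polynomial identity.\<close>

lemma lagrange_coeff_rec_Suc:
  "lagrange_coeff (Suc r) (Suc m) (Suc s) - lagrange_coeff r (Suc m) (Suc s) -
     (lagrange_coeff (r + 3) (Suc m) s - lagrange_coeff (r + 2) (Suc m) s) =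
   lagrange_coeff (r + 2) m (Suc s)"
proof -
  define K :: real where "K = fact (m + s) * fact (2 * m + 2 * s + r + 3) /
    (fact s * fact m * fact m * fact (m + 2 * s + r + 3))"
  \<comment> \<open>The quotients of neighbouring factorials by which the terms differ from
    \<open>K\<close>.\<close>
  define a b c where "a = real m + real s + 1"
    and "b = 2 * real m + 2 * real s + real r + 4" and "c = real m + 2 * real s + real r + 4"
  have f: "fact (Suc (m + s)) = a * fact (m + s)"
    "fact (2 * m + 2 * s + r + 4) = b * fact (2 * m + 2 * s + r + 3)"
    "fact (m + 2 * s + r + 4) = c * fact (m + 2 * s + r + 3)"
    "fact (Suc m) = (real m + 1) * fact m" "fact (Suc s) = (real s + 1) * fact s"
    unfolding a_def b_def c_def by (simp_all add: eval_nat_numeral algebra_simps)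
  have pos: "c > 0" unfolding c_def by simp
  have arg: "Suc m + Suc s - 1 = Suc (m + s)" "2 * Suc m + 2 * Suc s + Suc r - 1 = 2 * m + 2 * s + r + 4"
    "2 * Suc m + 2 * Suc s + r - 1 = 2 * m + 2 * s + r + 3" "Suc m + 2 * Suc s + Suc r = m + 2 * s + r + 4"
    "Suc m + 2 * Suc s + r = m + 2 * s + r + 3" "Suc m + s - 1 = m + s"
    "2 * Suc m + 2 * s + (r + 3) - 1 = 2 * m + 2 * s + r + 4" "Suc m + 2 * s + (r + 3) = m + 2 * s + r + 4"
    "2 * Suc m + 2 * s + (r + 2) - 1 = 2 * m + 2 * s + r + 3" "Suc m + 2 * s + (r + 2) = m + 2 * s + r + 3"
    "m + Suc s - 1 = m + s" "2 * m + 2 * Suc s + (r + 2) - 1 = 2 * m + 2 * s + r + 3"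
    "m + 2 * Suc s + (r + 2) = m + 2 * s + r + 4" "Suc m - 1 = m" "Suc m \<noteq> 0"
    by auto
  have "lagrange_coeff (Suc r) (Suc m) (Suc s) =
      (real r + 1) * a * b * K / ((real s + 1) * (real m + 1) * c)"
    unfolding lagrange_coeff_def arg f K_def by (simp add: mult_ac)
  moreover have "lagrange_coeff r (Suc m) (Suc s) = real r * a * K / ((real s + 1) * (real m + 1))"
    unfolding lagrange_coeff_def arg f K_def by (simp add: mult_ac)
  moreover have "lagrange_coeff (r + 3) (Suc m) s = (real r + 3) * b * K / ((real m + 1) * c)"
    unfolding lagrange_coeff_def arg f K_def by (simp add: mult_ac)
  moreover have "lagrange_coeff (r + 2) (Suc m) s = (real r + 2) * K / (real m + 1)"
    unfolding lagrange_coeff_def arg f K_def by (simp add: mult_ac)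
  \<comment> \<open>For \<open>m > 0\<close> the factor \<open>real m\<close> turns one
    \<open>fact m\<close> in \<open>K\<close> into \<open>fact (m - 1)\<close>; for
    \<open>m = 0\<close> both sides vanish.\<close>
  moreover have "lagrange_coeff (r + 2) m (Suc s) = (real r + 2) * real m * K / ((real s + 1) * c)"
  proof (cases m)
    case (Suc n)
    have "real m * fact (m - 1) = fact m" using Suc by simp
    then have m: "real m / fact m = 1 / fact (m - 1)"
      using Suc by (metis mult.right_neutral mult_divide_mult_cancel_left of_nat_0_eq_iff nat.distinct(1))
    have "lagrange_coeff (r + 2) m (Suc s) = (real r + 2) * fact (m + s) * fact (2 * m + 2 * s + r + 3) *
        (1 / fact (m - 1)) / ((real s + 1) * fact s * fact m * (c * fact (m + 2 * s + r + 3)))"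
      using Suc unfolding lagrange_coeff_def arg f by (simp add: mult_ac)
    then show ?thesis unfolding m[symmetric] K_def by (simp add: mult_ac)
  qed (simp add: lagrange_coeff_def)
  moreover have "(real r + 1) * a * b * K / ((real s + 1) * (real m + 1) * c) -
      real r * a * K / ((real s + 1) * (real m + 1)) -
      ((real r + 3) * b * K / ((real m + 1) * c) - (real r + 2) * K / (real m + 1)) =
      (real r + 2) * real m * K / ((real s + 1) * c)"
  proof -
    have *: "x / (p * q * c) - y / (p * q) - (z / (q * c) - w / q) = t / (p * c)"
      if "x - y * c - (z * p - w * p * c) = t * q" "p > 0" "q > 0" for x y z w t p q :: real
    proof -
      have "x / (p * q * c) - y / (p * q) - (z / (q * c) - w / q) =
          (x - y * c - (z * p - w * p * c)) / (p * q * c)"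
        using that(2,3) pos by (simp add: field_simps)
      also have "\<dots> = t / (p * c)"
        unfolding that(1) using that(2,3) pos by simp
      finally show ?thesis .
    qed
    show ?thesis by (rule *) (simp_all add: a_def b_def c_def algebra_simps)
  qed
  ultimately show ?thesis by simp
qed

text \<open>At \<open>m = 0\<close> the coefficients do not depend on \<open>r\<close>, so the
  difference cancels.\<close>

lemma lagrange_coeff_rec:
  "lagrange_coeff (Suc r) m s = lagrange_coeff r m s +
     (if s = 0 then 0 else lagrange_coeff (r + 3) m (s - 1) - lagrange_coeff (r + 2) m (s - 1)) +
     (if m = 0 then 0 else lagrange_coeff (r + 2) (m - 1) s)"
proof (cases m)
  case 0
  then show ?thesis by (simp add: lagrange_coeff_def)
next
  case (Suc m')
  then show ?thesis
    using lagrange_coeff_rec_s0[of r m'] lagrange_coeff_rec_Suc[of r m'] by (cases s) (auto simp: algebra_simps)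
qed

text \<open>\<open>r > 0\<close> excludes the quotient 0 / 0 at \<open>m = s = 0\<close>. The upper
  arguments are real because \<open>m + s - 1\<close> is -1 there.\<close>

lemma lagrange_coeff_gbinomial:
  assumes "r > 0"
  shows "lagrange_coeff r m s = real r / (real m + 2 * real s + real r) *
     ((real m + real s - 1) gchoose s) * ((2 * real m + 2 * real s + real r - 1) gchoose m)"
proof (cases m)
  case 0
  \<comment> \<open>Agrees with the value that \<open>lagrange_coeff\<close> assigns at
    \<open>m = 0\<close>, \<open>s > 0\<close>.\<close>
  have "(real s - 1 gchoose s) = 0" if "s > 0"
  proof -
    have "real s - 1 = real (s - 1)" using that by simp
    then show ?thesis using that by (simp only: flip: binomial_gbinomial) simp
  qed
  then show ?thesis using 0 assms by (cases "s = 0") (auto simp: lagrange_coeff_def)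
next
  case (Suc m')
  have "real m + real s - 1 = real (m' + s)" "2 * real m + 2 * real s + real r - 1 = real (2 * m + 2 * s + r - 1)"
    using Suc assms by auto
  moreover have "real ((m' + s) choose s) = fact (m' + s) / (fact s * fact m')"
    by (simp add: binomial_fact)
  moreover have "2 * m + 2 * s + r - 1 - m = m + 2 * s + r - 1" by simp
  then have "real ((2 * m + 2 * s + r - 1) choose m) =
      fact (2 * m + 2 * s + r - 1) / (fact m * fact (m + 2 * s + r - 1))"
    using assms by (subst binomial_fact) auto
  ultimately have "((real m + real s - 1) gchoose s) = fact (m' + s) / (fact s * fact m')"
    "((2 * real m + 2 * real s + real r - 1) gchoose m) =
      fact (2 * m + 2 * s + r - 1) / (fact m * fact (m + 2 * s + r - 1))"
    by (simp_all only: flip: binomial_gbinomial)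
  moreover have "fact (m + 2 * s + r) = (real m + 2 * real s + real r) * fact (m + 2 * s + r - 1)"
    using assms by (subst fact_reduce) auto
  ultimately show ?thesis using Suc by (simp add: lagrange_coeff_def del: fact_Suc)
qed

text \<open>The substitution \<open>t = z^3\<close>, which leads back to the equation of
  \<open>P\<close>.\<close>

definition power_coeff :: "nat \<Rightarrow> nat \<Rightarrow> real" where
  "power_coeff r n = (\<Sum>s\<le>n div 3. lagrange_coeff r (n - 3 * s) s)"

lemma power_coeff_0: "power_coeff 0 n = (if n = 0 then 1 else 0)"
proof -
  have "power_coeff 0 n = (\<Sum>s\<le>n div 3. if s = 0 then (if n = 0 then 1 else 0) else 0)"
    unfolding power_coeff_def by (intro sum.cong) (auto simp: lagrange_coeff_0)
  then show ?thesis by simp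
qed

lemma power_coeff_rec:
  "power_coeff (Suc r) n = power_coeff r n +
     (if n < 3 then 0 else power_coeff (r + 3) (n - 3) - power_coeff (r + 2) (n - 3)) +
     (if n = 0 then 0 else power_coeff (r + 2) (n - 1))"
proof -
  have A: "(\<Sum>s\<le>n div 3. if s = 0 then 0 else lagrange_coeff r' (n - 3 * s) (s - 1)) =
     (if n < 3 then 0 else power_coeff r' (n - 3))" for r'
  proof (cases "n < 3")
    case False
    then have "n div 3 = Suc ((n - 3) div 3)" by (simp add: le_div_geq)
    then show ?thesis using False
      by (simp add: power_coeff_def sum.atMost_Suc_shift del: sum.atMost_Suc)
  qed simp
  \<comment> \<open>The guard removes the term with \<open>3 * s = n\<close>, which is exactly the
    term beyond the range for \<open>n - 1\<close>.\<close>
  have B: "(\<Sum>s\<le>n div 3. if n - 3 * s = 0 then 0 else lagrange_coeff (r + 2) (n - 3 * s - 1) s) =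
     (if n = 0 then 0 else power_coeff (r + 2) (n - 1))"
  proof (cases "n = 0")
    case False
    have "(\<Sum>s\<le>n div 3. if n - 3 * s = 0 then 0 else lagrange_coeff (r + 2) (n - 3 * s - 1) s) =
        (\<Sum>s\<le>(n - 1) div 3. if n - 3 * s = 0 then 0 else lagrange_coeff (r + 2) (n - 3 * s - 1) s)"
      by (rule sum.mono_neutral_right) auto
    also have "\<dots> = power_coeff (r + 2) (n - 1)"
      unfolding power_coeff_def using False by (intro sum.cong) auto
    finally show ?thesis using False by simp
  qed simp
  have "power_coeff (Suc r) n = (\<Sum>s\<le>n div 3. lagrange_coeff r (n - 3 * s) s +
     ((if s = 0 then 0 else lagrange_coeff (r + 3) (n - 3 * s) (s - 1)) -
      (if s = 0 then 0 else lagrange_coeff (r + 2) (n - 3 * s) (s - 1))) +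
     (if n - 3 * s = 0 then 0 else lagrange_coeff (r + 2) (n - 3 * s - 1) s))"
    unfolding power_coeff_def by (intro sum.cong refl) (subst lagrange_coeff_rec, simp)
  also have "\<dots> = power_coeff r n +
     ((if n < 3 then 0 else power_coeff (r + 3) (n - 3)) - (if n < 3 then 0 else power_coeff (r + 2) (n - 3))) +
     (if n = 0 then 0 else power_coeff (r + 2) (n - 1))"
    unfolding sum.distrib sum_subtractf A B by (simp add: power_coeff_def)
  finally show ?thesis by simp
qed

section \<open>Powers of a solution of the equation\<close>

lemma P_equation_iff:
  "P_equation P \<longleftrightarrow> (P - 1) * (1 - fps_X ^ 3 * P ^ 2) = fps_X * P ^ 2"
proof -
  let ?U = "1 - fps_X ^ 3 * P ^ 2"
  have U: "fps_nth ?U 0 \<noteq> 0" by simp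
  then have "?U \<noteq> 0" by (metis fps_zero_nth)
  have "fps_X * P ^ 2 / ?U = fps_X * P ^ 2 * inverse ?U" using U by (rule fps_divide_unit)
  moreover have "inverse ?U * ?U = 1" using U by (rule inverse_mult_eq_1)
  ultimately have 1: "fps_X * P ^ 2 / ?U * ?U = fps_X * P ^ 2" by (simp add: mult.assoc)
  have "P_equation P \<longleftrightarrow> P - 1 = fps_X * P ^ 2 / ?U"
    unfolding P_equation_def by (metis add_diff_cancel_left' diff_add_cancel add.commute)
  also have "\<dots> \<longleftrightarrow> (P - 1) * ?U = fps_X * P ^ 2 / ?U * ?U"
    using mult_right_cancel[OF \<open>?U \<noteq> 0\<close>] by (rule sym)
  finally show ?thesis unfolding 1 .
qed

text \<open>
  Multiplied by \<open>P\<^sup>r\<close>, the equation expresses \<open>P\<^bsup>r+1\<^esup> - P\<^sup>r\<close> by terms of the form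
  \<open>z\<^sup>i P\<^sup>j\<close> with \<open>i > 0\<close>, so it determines the coefficients of all powers of \<open>P\<close>.
\<close>

lemma P_equation_power_nth:
  assumes "P_equation P"
  shows "fps_nth (P ^ r) n = power_coeff r n"
proof (induction n arbitrary: r rule: less_induct)
  case (less n)
  show ?case
  \<comment> \<open>\<open>P^r\<close> occurs with the same coefficient index but smaller exponent,
    the higher powers only with smaller index; hence an induction on \<open>r\<close> inside one on
    \<open>n\<close>.\<close>
  proof (induction r)
    case 0
    show ?case by (simp add: power_coeff_0)
  next
    case (Suc r)
    have eq: "(P - 1) * (1 - fps_X ^ 3 * P ^ 2) * P ^ r = fps_X * P ^ 2 * P ^ r"
      using assms by (simp add: P_equation_iff)
    have "P ^ Suc r = P ^ r + (fps_X ^ 3 * P ^ (r + 3) - fps_X ^ 3 * P ^ (r + 2)) + fps_X * P ^ (r + 2)"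
      using eq by (simp add: algebra_simps power_add power2_eq_square power3_eq_cube)
    then have "fps_nth (P ^ Suc r) n = fps_nth (P ^ r) n +
        (if n < 3 then 0 else fps_nth (P ^ (r + 3)) (n - 3) - fps_nth (P ^ (r + 2)) (n - 3)) +
        (if n = 0 then 0 else fps_nth (P ^ (r + 2)) (n - 1))"
      by (simp add: fps_X_power_mult_nth del: power_Suc add_2_eq_Suc')
    also have "\<dots> = power_coeff (Suc r) n"
      unfolding power_coeff_rec Suc.IH using less.IH
      by (simp del: power_Suc add_2_eq_Suc')
    finally show ?case .
  qed
qed

lemma P_equation_unique: "P_equation P \<Longrightarrow> P_equation P' \<Longrightarrow> P = P'"
  using P_equation_power_nth[of _ 1] by (simp add: fps_eq_iff)

text \<open>Expands \<open>R = z^2 P^2 / (1 - z^3 P^3)\<close> as a geometric series. The factor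
  \<open>P^a\<close> absorbs the powers produced by unrolling, and \<open>j < Suc n div 3\<close>
  means \<open>3 * j + 2 <= n\<close>.\<close>

lemma geometric_power_nth:
  fixes P R :: "real fps"
  assumes "R = fps_X ^ 2 * P ^ 2 + fps_X ^ 3 * P ^ 3 * R"
  shows "fps_nth (P ^ a * R) n = (\<Sum>j<Suc n div 3. fps_nth (P ^ (3 * j + 2 + a)) (n - 2 - 3 * j))"
proof (induction n arbitrary: a rule: less_induct)
  case (less n)
  have "P ^ a * R = P ^ a * (fps_X ^ 2 * P ^ 2 + fps_X ^ 3 * P ^ 3 * R)"
    by (rule arg_cong[OF assms])
  also have "\<dots> = fps_X ^ 2 * P ^ (2 + a) + fps_X ^ 3 * (P ^ (3 + a) * R)"
    by (simp only: power_add algebra_simps)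
  finally have "P ^ a * R = fps_X ^ 2 * P ^ (2 + a) + fps_X ^ 3 * (P ^ (3 + a) * R)" .
  then have n: "fps_nth (P ^ a * R) n = (if n < 2 then 0 else fps_nth (P ^ (2 + a)) (n - 2)) +
      (if n < 3 then 0 else fps_nth (P ^ (3 + a) * R) (n - 3))"
    by (simp add: fps_X_power_mult_nth)
  consider "n < 2" | "n = 2" | "3 \<le> n" by linarith
  then show ?case
  proof cases
    case 3
    define F where "F j = fps_nth (P ^ (3 * j + 2 + a)) (n - 2 - 3 * j)" for j
    have "Suc n div 3 = Suc (Suc (n - 3) div 3)" using 3 by (simp add: le_div_geq)
    then have "(\<Sum>j<Suc n div 3. F j) = F 0 + (\<Sum>j<Suc (n - 3) div 3. F (Suc j))"
      by (simp only: sum.lessThan_Suc_shift)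
    moreover have "3 * Suc j + 2 + a = 3 * j + 2 + (3 + a)" "n - 2 - 3 * Suc j = n - 3 - 2 - 3 * j" for j
      by simp_all
    then have "fps_nth (P ^ (3 + a) * R) (n - 3) = (\<Sum>j<Suc (n - 3) div 3. F (Suc j))"
      using 3 less[of "n - 3" "3 + a"] unfolding F_def by (simp add: add_ac)
    moreover have "fps_nth (P ^ (2 + a)) (n - 2) = F 0" unfolding F_def by simp
    ultimately show ?thesis using 3 unfolding n F_def by simp
  qed (unfold n, simp_all)
qed

section \<open>The two formulas\<close>

definition P_words :: "real fps" where
  "P_words = fps_shift 1 (bars_gf gap_words)"

text \<open>Every gap contains a \<open>Bar\<close>, so the shift loses no coefficient.\<close>

lemma gap_words_gf_shift: "bars_gf gap_words = fps_X * P_words"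
proof -
  have "{w \<in> gap_words. bars w = 0} = {}" using stars_gap_loop(1) by fastforce
  then have "fps_nth (bars_gf gap_words) 0 = 0" by (simp only: bars_gf_nth card.empty of_nat_0)
  then show ?thesis
    unfolding P_words_def by (intro fps_ext) (auto simp: fps_X_mult_nth)
qed

text \<open>The walks thus also prove that a solution exists. It results from eliminating
  \<open>E = z * (P - 1)\<close> and cancelling one \<open>z\<close>.\<close>

lemma P_equation_P_words: "P_equation P_words"
proof -
  define E where "E = bars_gf loop_words"
  have E: "E = fps_X * (P_words - 1)"
    using gap_words_gf gap_words_gf_shift unfolding E_def by (simp add: algebra_simps)
  have "E = (fps_X * P_words) ^ 2 * (1 + fps_X * E)"
    using loop_words_gf gap_words_gf_shift unfolding E_def by simp
  then have "fps_X * ((P_words - 1) * (1 - fps_X ^ 3 * P_words ^ 2)) = fps_X * (fps_X * P_words ^ 2)"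
    unfolding E by (simp add: algebra_simps power2_eq_square power3_eq_cube)
  then show ?thesis unfolding P_equation_iff by simp
qed

lemma ex1_P_equation: "\<exists>!P. P_equation P"
  using P_equation_P_words P_equation_unique by blast

lemma P_equation_P_series: "P_equation P_series"
  unfolding P_series_def using ex1_P_equation by (rule theI')

lemma Q_eq_power_coeff_sum:
  assumes "0 < n"
  shows "real (Q n) = (\<Sum>j | 3 * j < n. power_coeff (3 * j + 2) (n - 1 - 3 * j))"
proof -
  have "bars_gf closed_words = fps_X ^ 2 * P_words ^ 2 + fps_X ^ 3 * P_words ^ 3 * bars_gf closed_words"
    using closed_words_gf unfolding gap_words_gf_shift power_mult_distrib .
  \<comment> \<open>A polygon with \<open>n + 2\<close> vertices has \<open>n + 1\<close> bars,
    hence the coefficient at \<open>Suc n\<close>.\<close>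
  from geometric_power_nth[OF this, of 0 "Suc n"]
  have "real (Q n) = (\<Sum>j<Suc (Suc n) div 3. power_coeff (3 * j + 2) (n - 1 - 3 * j))"
    using assms by (simp add: Q_eq_card_closed_words bars_gf_nth P_equation_power_nth[OF P_equation_P_words]
        del: add_2_eq_Suc' power_Suc)
  moreover have "{..<Suc (Suc n) div 3} = {j. 3 * j < n}" by auto
  ultimately show ?thesis by simp
qed

text \<open>The term with \<open>3 * k = n\<close> has \<open>m = 0\<close> and
  \<open>k > 0\<close>, so it is 0.\<close>

lemma power_coeff_eq_sum_strict:
  assumes "0 < n"
  shows "power_coeff r n = (\<Sum>k | 3 * k < n. lagrange_coeff r (n - 3 * k) k)"
  unfolding power_coeff_def
proof (rule sum.mono_neutral_right)
  show "\<forall>k\<in>{..n div 3} - {k. 3 * k < n}. lagrange_coeff r (n - 3 * k) k = 0"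
    using assms by (auto simp: lagrange_coeff_def)
qed auto

text \<open>Substitutes \<open>k = j + s\<close>, after which the range of \<open>k\<close> no
  longer depends on \<open>s\<close>.\<close>

lemma sum_power_coeff_reindex:
  "(\<Sum>j | 3 * j < n. power_coeff (3 * j + 2) (n - 1 - 3 * j)) =
   (\<Sum>k | 3 * k < n. \<Sum>s\<le>k. lagrange_coeff (3 * (k - s) + 2) (n - 1 - 3 * k) s)"
proof -
  have fin: "finite {k. 3 * k < n}" by (rule finite_subset[of _ "{..n}"]) auto
  have "(\<Sum>j | 3 * j < n. power_coeff (3 * j + 2) (n - 1 - 3 * j)) =
     (\<Sum>(j, s)\<in>(SIGMA j:{j. 3 * j < n}. {..(n - 1 - 3 * j) div 3}).
        lagrange_coeff (3 * j + 2) (n - 1 - 3 * j - 3 * s) s)"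
    unfolding power_coeff_def using fin by (subst sum.Sigma) auto
  also have "\<dots> = (\<Sum>(k, s)\<in>(SIGMA k:{k. 3 * k < n}. {..k}).
        lagrange_coeff (3 * (k - s) + 2) (n - 1 - 3 * k) s)"
    by (rule sum.reindex_bij_witness[where i = "\<lambda>(k, s). (k - s, s)" and j = "\<lambda>(j, s). (j + s, s)"])
      (auto simp: algebra_simps)
  also have "\<dots> = (\<Sum>k | 3 * k < n. \<Sum>s\<le>k. lagrange_coeff (3 * (k - s) + 2) (n - 1 - 3 * k) s)"
    using fin by (subst sum.Sigma) auto
  finally show ?thesis .
qed

theorem theorem2p4:
  "(\<exists>!P. P_equation P) \<and>
   (\<forall>n::nat. n > 0 \<longrightarrow>
      fps_nth P_series n =
        (\<Sum>k | 3 * k < n.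
           1 / (real n - real k + 1)
           * ((real n - 2 * real k - 1) gchoose k)
           * ((2 * real n - 4 * real k) gchoose (n - 3 * k))) \<and>
      real (Q n) =
        (\<Sum>k | 3 * k < n. \<Sum>s\<le>k.
           (3 * (real k - real s) + 2) / (real n - real s + 1)
           * ((real n - 3 * real k + real s - 2) gchoose s)
           * ((2 * real n - 3 * real k - real s - 1) gchoose (n - 3 * k - 1))))"
proof (intro conjI allI impI)
  show "\<exists>!P. P_equation P" by (rule ex1_P_equation)
next
  fix n :: nat assume n: "n > 0"
  \<comment> \<open>The closed form at \<open>r = 1\<close>, \<open>m = n - 3 * k\<close>;
    \<open>3 * k < n\<close> makes the subtraction exact.\<close>
  have "lagrange_coeff 1 (n - 3 * k) k = 1 / (real n - real k + 1)
      * ((real n - 2 * real k - 1) gchoose k) * ((2 * real n - 4 * real k) gchoose (n - 3 * k))"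
    if k: "3 * k < n" for k
  proof -
    have m: "real (n - 3 * k) = real n - 3 * real k" using k by simp
    have "real n - 3 * real k + 2 * real k + 1 = real n - real k + 1"
      "real n - 3 * real k + real k - 1 = real n - 2 * real k - 1"
      "2 * (real n - 3 * real k) + 2 * real k + 1 - 1 = 2 * real n - 4 * real k" by simp_all
    then show ?thesis by (simp only: lagrange_coeff_gbinomial[of 1] m of_nat_1 zero_less_one)
  qed
  then show "fps_nth P_series n = (\<Sum>k | 3 * k < n. 1 / (real n - real k + 1)
           * ((real n - 2 * real k - 1) gchoose k)
           * ((2 * real n - 4 * real k) gchoose (n - 3 * k)))"
    using P_equation_power_nth[OF P_equation_P_series, of 1 n] n
    by (simp add: power_coeff_eq_sum_strict)
next
  fix n :: nat assume n: "n > 0"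
  \<comment> \<open>The closed form at \<open>r = 3 * (k - s) + 2\<close>, which is positive, and
    \<open>m = n - 1 - 3 * k\<close>.\<close>
  have "lagrange_coeff (3 * (k - s) + 2) (n - 1 - 3 * k) s =
      (3 * (real k - real s) + 2) / (real n - real s + 1)
      * ((real n - 3 * real k + real s - 2) gchoose s)
      * ((2 * real n - 3 * real k - real s - 1) gchoose (n - 3 * k - 1))"
    if k: "3 * k < n" "s \<le> k" for k s
  proof -
    have m: "real (n - 1 - 3 * k) = real n - 1 - 3 * real k"
      "real (3 * (k - s) + 2) = 3 * (real k - real s) + 2" "n - 3 * k - 1 = n - 1 - 3 * k"
      using k by (simp_all add: of_nat_diff)
    have "real n - 1 - 3 * real k + 2 * real s + (3 * (real k - real s) + 2) = real n - real s + 1"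
      "real n - 1 - 3 * real k + real s - 1 = real n - 3 * real k + real s - 2"
      "2 * (real n - 1 - 3 * real k) + 2 * real s + (3 * (real k - real s) + 2) - 1 =
        2 * real n - 3 * real k - real s - 1" by simp_all
    moreover have "0 < 3 * (k - s) + 2" by simp
    ultimately show ?thesis by (simp only: lagrange_coeff_gbinomial m)
  qed
  then show "real (Q n) = (\<Sum>k | 3 * k < n. \<Sum>s\<le>k.
           (3 * (real k - real s) + 2) / (real n - real s + 1)
           * ((real n - 3 * real k + real s - 2) gchoose s)
           * ((2 * real n - 3 * real k - real s - 1) gchoose (n - 3 * k - 1)))"
    unfolding Q_eq_power_coeff_sum[OF n] sum_power_coeff_reindex by (intro sum.cong) auto
qed

end
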